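(* Let $\mathcal{C}$ be a Cartesian closed monoidal category with pullbacks, with unit object $\mathbf{1}$. Suppose that the functor $\mathrm{Hom}_{\mathcal{C}}(\mathbf{1},-)$ from $\mathcal{C}$ to sets is faithful. Suppose in addition that for any two objects $Y$, $Z$ in $\mathcal{C}$ and any morphism $\zeta:Z\to\mathbf{Hom}(Y,Y)$, if the map $\mathrm{Hom}_{\mathcal{C}}(\mathbf{1},\zeta):\mathrm{Hom}_{\mathcal{C}}(\mathbf{1},Z)\to\mathrm{Hom}_{\mathcal{C}}(\mathbf{1},\mathbf{Hom}(Y,Y))\cong\mathrm{Hom}_{\mathcal{C}}(Y,Y)$ factors through the inclusion $\mathrm{Aut}_{\mathcal{C}}(Y)\to\mathrm{Hom}_{\mathcal{C}}(Y,Y)$, then the morphism $\zeta$ factors through the morphism $\mathbf{Aut}(Y)\to\mathbf{Hom}(Y,Y)$. Let $X$ be an object in $\mathcal{C}$. For any positive integer $d$ the morphism $\mathbf{L}(X^d,X)\to\mathbf{Hom}(X^d,X)$ is a monomorphism, and, with $d$ running over the positive integers, these monomorphisms form a suboperad of the internal endomorphism operad of $X$ in $\mathcal{C}$.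
   Context: Categories are assumed to be essentially small. A Cartesian closed monoidal category is a monoidal category whose monoidal product is a product in the category (so the unit object $\mathbf{1}$ is terminal) and which has an internal Hom $\mathbf{Hom}:\mathcal{C}^{\mathrm{op}}\times\mathcal{C}\to\mathcal{C}$, that is, for every object $X$ the functor $X\times-$ is left adjoint to $\mathbf{Hom}(X,-)$. In particular there are natural bijections $\mathrm{Hom}_{\mathcal{C}}(\mathbf{1},\mathbf{Hom}(X,Y))\cong\mathrm{Hom}_{\mathcal{C}}(X,Y)$. A morphism between objects built from internal Homs lifts a map of sets if that map is its image under $\mathrm{Hom}_{\mathcal{C}}(\mathbf{1},-)$ modulo canonical identifications. Internal automorphism object. For an object $Y$, $\mathbf{Aut}(Y)$ with the morphism $(\gamma,\gamma'):\mathbf{Aut}(Y)\to\mathbf{Hom}(Y,Y)\times\mathbf{Hom}(Y,Y)$ is defined as the pullback of $\nu:\mathbf{Hom}(Y,Y)\times\mathbf{Hom}(Y,Y)\to\mathbf{Hom}(Y,Y)\times\mathbf{Hom}(Y,Y)$ along $\mathbf{1}\to\mathbf{Hom}(Y,Y)\times\mathbf{Hom}(Y,Y)$. Here $\nu$ is the internal composition morphism lifting $(\alpha,\beta)\mapsto(\beta\circ\alpha,\alpha\circ\beta)$, and the morphism from $\mathbf{1}$ has both components corresponding to $\mathrm{Id}_Y$. The morphism $\mathbf{Aut}(Y)\to\mathbf{Hom}(Y,Y)$ is the first component $\gamma$; it lifts the inclusion $\mathrm{Aut}_{\mathcal{C}}(Y)\to\mathrm{Hom}_{\mathcal{C}}(Y,Y)$.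 Latin hypercubes. For $d\ge1$ and $1\le s\le d+1$ let $\tau^{d+1}_s:X^{d+1}\to X^d$ be the projection discarding coordinate $s$. For $1\le i\le d$ let $\hat\gamma_i:\mathbf{Hom}(X^d,X)\to\mathbf{Hom}(X^d,X^d)$ be the morphism lifting the map $\mathrm{Hom}_{\mathcal{C}}(X^d,X)\to\mathrm{Hom}_{\mathcal{C}}(X^d,X^d)$, $f\mapsto\tau^{d+1}_i\circ(\mathrm{Id}_{X^d},f)$; explicitly, $\hat\gamma_i$ is the adjoint transpose of $\tau^{d+1}_i\circ(\mathrm{pr}_1,\mathrm{ev}):X^d\times\mathbf{Hom}(X^d,X)\to X^d$, where $\mathrm{ev}$ is evaluation. Let $\hat\gamma=(\hat\gamma_i)_{1\le i\le d}:\mathbf{Hom}(X^d,X)\to\prod_{i=1}^d\mathbf{Hom}(X^d,X^d)$, and let $\hat\iota:\prod_{i=1}^d\mathbf{Aut}(X^d)\to\prod_{i=1}^d\mathbf{Hom}(X^d,X^d)$ be the product of $d$ copies of $\mathbf{Aut}(X^d)\to\mathbf{Hom}(X^d,X^d)$. Then $\mathbf{L}(X^d,X)$, with its morphism $\mathbf{L}(X^d,X)\to\mathbf{Hom}(X^d,X)$, is defined as the pullback of $\hat\iota$ along $\hat\gamma$. (It is an internal version of the set $\mathcal{L}_{\mathcal{C}}(X^d,X)$ of all $f\in\mathrm{Hom}_{\mathcal{C}}(X^d,X)$ such that $\tau^{d+1}_s\circ(\mathrm{Id}_{X^d},f)$ is an automorphism of $X^d$ for $1\le s\le d+1$.) Operads.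 The internal endomorphism operad of $X$ consists of the objects $\mathbf{Hom}(X^n,X)$, $n\ge1$, with the symmetric group actions induced by permuting the coordinates of $X^n$, the unit $\mathbf{1}\to\mathbf{Hom}(X,X)$ corresponding to $\mathrm{Id}_X$, and, for $1\le i\le d$, the structural morphisms $-\circ_i-:\mathbf{Hom}(X^d,X)\times\mathbf{Hom}(X^e,X)\to\mathbf{Hom}(X^{d+e-1},X)$ defined via internal composition and products, lifting $(f,g)\mapsto f\circ(\mathrm{Id}_{X^{i-1}}\times g\times\mathrm{Id}_{X^{d-i}})$. A family of monomorphisms $\mathbf{L}(X^d,X)\to\mathbf{Hom}(X^d,X)$ forms a suboperad if the unit factors through $\mathbf{L}(X,X)$, the symmetric group actions restrict to the $\mathbf{L}(X^d,X)$, and the morphisms $-\circ_i-$ restrict to morphisms $\mathbf{L}(X^d,X)\times\mathbf{L}(X^e,X)\to\mathbf{L}(X^{d+e-1},X)$. *)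

theory Defs
  imports "HOL-Library.FuncSet" "HOL-Combinatorics.Permutations"
begin

section \<open>Categories\<close>

text \<open>Objects and arrows are sets in arbitrary types, so categories are small.
  Composition \<open>g \<cdot> f\<close> is in applicative order: first \<open>f\<close>, then \<open>g\<close>.\<close>

record ('o, 'm) cat =
  Obj :: "'o set"
  Arr :: "'m set"
  Dom :: "'m \<Rightarrow> 'o"
  Cod :: "'m \<Rightarrow> 'o"
  Ident :: "'o \<Rightarrow> 'm"
  Comp :: "'m \<Rightarrow> 'm \<Rightarrow> 'm"  (infixr \<open>\<cdot>\<index>\<close> 70)

definition hom :: "('o, 'm, 'r) cat_scheme \<Rightarrow> 'o \<Rightarrow> 'o \<Rightarrow> 'm set" where
  "hom C A B = {f \<in> Arr C. Dom C f = A \<and> Cod C f = B}"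

locale category =
  fixes C :: "('o, 'm, 'r) cat_scheme" (structure)
  assumes dom_closed: "f \<in> Arr C \<Longrightarrow> Dom C f \<in> Obj C"
    and cod_closed: "f \<in> Arr C \<Longrightarrow> Cod C f \<in> Obj C"
    and id_closed: "A \<in> Obj C \<Longrightarrow> Ident C A \<in> hom C A A"
    and comp_closed: "\<lbrakk>f \<in> hom C A B; g \<in> hom C B D\<rbrakk> \<Longrightarrow> g \<cdot> f \<in> hom C A D"
    and comp_id: "f \<in> hom C A B \<Longrightarrow> f \<cdot> Ident C A = f"
    and id_comp: "f \<in> hom C A B \<Longrightarrow> Ident C B \<cdot> f = f"
    and comp_assoc: "\<lbrakk>f \<in> hom C A B; g \<in> hom C B D; h \<in> hom C D E\<rbrakk>
      \<Longrightarrow> (h \<cdot> g) \<cdot> f = h \<cdot> (g \<cdot> f)"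

definition monic :: "('o, 'm, 'r) cat_scheme \<Rightarrow> 'm \<Rightarrow> bool" where
  "monic C m \<longleftrightarrow> m \<in> Arr C \<and>
     (\<forall>W \<in> Obj C. \<forall>u \<in> hom C W (Dom C m). \<forall>v \<in> hom C W (Dom C m).
        m \<cdot>\<^bsub>C\<^esub> u = m \<cdot>\<^bsub>C\<^esub> v \<longrightarrow> u = v)"

definition factors_through :: "('o, 'm, 'r) cat_scheme \<Rightarrow> 'm \<Rightarrow> 'm \<Rightarrow> bool" where
  "factors_through C f m \<longleftrightarrow> (\<exists>u \<in> hom C (Dom C f) (Dom C m). f = m \<cdot>\<^bsub>C\<^esub> u)"

definition automorphisms :: "('o, 'm, 'r) cat_scheme \<Rightarrow> 'o \<Rightarrow> 'm set" where
  "automorphisms C Y =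
     {f \<in> hom C Y Y. \<exists>g \<in> hom C Y Y. g \<cdot>\<^bsub>C\<^esub> f = Ident C Y \<and> f \<cdot>\<^bsub>C\<^esub> g = Ident C Y}"

section \<open>Cartesian closed categories with pullbacks\<close>

text \<open>The terminal object, binary products, internal Homs and pullbacks are chosen, and the
  choice is arbitrary. The internal Hom is given by the counit
  \<open>Ev X Y : X \<times> Hom(X, Y) \<rightarrow> Y\<close> of the adjunction of \<open>X \<times> -\<close> and \<open>Hom(X, -)\<close>;
  the functoriality of \<open>Hom\<close> in both arguments is determined by its universal property.\<close>

record ('o, 'm) ccc = "('o, 'm) cat" +
  One :: 'o
  Prod :: "'o \<Rightarrow> 'o \<Rightarrow> 'o"
  Pr1 :: "'o \<Rightarrow> 'o \<Rightarrow> 'm"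
  Pr2 :: "'o \<Rightarrow> 'o \<Rightarrow> 'm"
  IHom :: "'o \<Rightarrow> 'o \<Rightarrow> 'o"
  Ev :: "'o \<Rightarrow> 'o \<Rightarrow> 'm"

record ('o, 'm) ccc_pb = "('o, 'm) ccc" +
  Pb :: "'m \<Rightarrow> 'm \<Rightarrow> 'o"
  Pb1 :: "'m \<Rightarrow> 'm \<Rightarrow> 'm"
  Pb2 :: "'m \<Rightarrow> 'm \<Rightarrow> 'm"

text \<open>\<open>bang C W : W \<rightarrow> 1\<close>; \<open>pair C f g = (f, g) : W \<rightarrow> A \<times> B\<close> for \<open>f : W \<rightarrow> A\<close>, \<open>g : W \<rightarrow> B\<close>;
  \<open>prod_map C f g = f \<times> g\<close>.\<close>

definition bang :: "('o, 'm, 'r) ccc_scheme \<Rightarrow> 'o \<Rightarrow> 'm" where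
  "bang C W = (THE h. h \<in> hom C W (One C))"

definition pair :: "('o, 'm, 'r) ccc_scheme \<Rightarrow> 'm \<Rightarrow> 'm \<Rightarrow> 'm" where
  "pair C f g = (THE h. h \<in> hom C (Dom C f) (Prod C (Cod C f) (Cod C g)) \<and>
     Pr1 C (Cod C f) (Cod C g) \<cdot>\<^bsub>C\<^esub> h = f \<and> Pr2 C (Cod C f) (Cod C g) \<cdot>\<^bsub>C\<^esub> h = g)"

definition prod_map :: "('o, 'm, 'r) ccc_scheme \<Rightarrow> 'm \<Rightarrow> 'm \<Rightarrow> 'm" where
  "prod_map C f g =
     pair C (f \<cdot>\<^bsub>C\<^esub> Pr1 C (Dom C f) (Dom C g)) (g \<cdot>\<^bsub>C\<^esub> Pr2 C (Dom C f) (Dom C g))"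

locale cartesian_closed_category = category C
  for C :: "('o, 'm, 'r) ccc_scheme" (structure) +
  assumes one_closed: "One C \<in> Obj C"
    and terminal: "W \<in> Obj C \<Longrightarrow> \<exists>!h. h \<in> hom C W (One C)"
    and prod_closed: "\<lbrakk>A \<in> Obj C; B \<in> Obj C\<rbrakk> \<Longrightarrow> Prod C A B \<in> Obj C"
    and pr1_closed: "\<lbrakk>A \<in> Obj C; B \<in> Obj C\<rbrakk> \<Longrightarrow> Pr1 C A B \<in> hom C (Prod C A B) A"
    and pr2_closed: "\<lbrakk>A \<in> Obj C; B \<in> Obj C\<rbrakk> \<Longrightarrow> Pr2 C A B \<in> hom C (Prod C A B) B"
    and prod_universal: "\<lbrakk>f \<in> hom C W A; g \<in> hom C W B\<rbrakk>
      \<Longrightarrow> \<exists>!h. h \<in> hom C W (Prod C A B) \<and> Pr1 C A B \<cdot> h = f \<and> Pr2 C A B \<cdot> h = g"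
    and ihom_closed: "\<lbrakk>A \<in> Obj C; B \<in> Obj C\<rbrakk> \<Longrightarrow> IHom C A B \<in> Obj C"
    and ev_closed: "\<lbrakk>A \<in> Obj C; B \<in> Obj C\<rbrakk> \<Longrightarrow> Ev C A B \<in> hom C (Prod C A (IHom C A B)) B"
    and ev_universal: "\<lbrakk>A \<in> Obj C; Z \<in> Obj C; h \<in> hom C (Prod C A Z) B\<rbrakk>
      \<Longrightarrow> \<exists>!k. k \<in> hom C Z (IHom C A B) \<and> Ev C A B \<cdot> prod_map C (Ident C A) k = h"

definition is_pullback ::
    "('o, 'm, 'r) cat_scheme \<Rightarrow> 'm \<Rightarrow> 'm \<Rightarrow> 'o \<Rightarrow> 'm \<Rightarrow> 'm \<Rightarrow> bool" where
  "is_pullback C f g P p q \<longleftrightarrow>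
     P \<in> Obj C \<and> p \<in> hom C P (Dom C f) \<and> q \<in> hom C P (Dom C g) \<and> f \<cdot>\<^bsub>C\<^esub> p = g \<cdot>\<^bsub>C\<^esub> q \<and>
     (\<forall>W \<in> Obj C. \<forall>u \<in> hom C W (Dom C f). \<forall>v \<in> hom C W (Dom C g).
        f \<cdot>\<^bsub>C\<^esub> u = g \<cdot>\<^bsub>C\<^esub> v \<longrightarrow>
        (\<exists>!h. h \<in> hom C W P \<and> p \<cdot>\<^bsub>C\<^esub> h = u \<and> q \<cdot>\<^bsub>C\<^esub> h = v))"

locale cartesian_closed_category_with_pullbacks = cartesian_closed_category C
  for C :: "('o, 'm, 'r) ccc_pb_scheme" (structure) +
  assumes pullbacks: "\<lbrakk>f \<in> hom C A K; g \<in> hom C B K\<rbrakk>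
      \<Longrightarrow> is_pullback C f g (Pb C f g) (Pb1 C f g) (Pb2 C f g)"

text \<open>\<open>adj_transpose C A Z h : Z \<rightarrow> Hom(A, B)\<close> is the adjoint transpose of \<open>h : A \<times> Z \<rightarrow> B\<close>.
  The functions \<open>point_of\<close> and \<open>arrow_of\<close> are the two directions of the canonical bijection
  between arrows \<open>X \<rightarrow> Y\<close> and arrows \<open>1 \<rightarrow> Hom(X, Y)\<close>.\<close>

definition adj_transpose :: "('o, 'm, 'r) ccc_scheme \<Rightarrow> 'o \<Rightarrow> 'o \<Rightarrow> 'm \<Rightarrow> 'm" where
  "adj_transpose C A Z h = (THE k. k \<in> hom C Z (IHom C A (Cod C h)) \<and>
     Ev C A (Cod C h) \<cdot>\<^bsub>C\<^esub> prod_map C (Ident C A) k = h)"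

definition point_of :: "('o, 'm, 'r) ccc_scheme \<Rightarrow> 'm \<Rightarrow> 'm" where
  "point_of C f = adj_transpose C (Dom C f) (One C) (f \<cdot>\<^bsub>C\<^esub> Pr1 C (Dom C f) (One C))"

definition arrow_of :: "('o, 'm, 'r) ccc_scheme \<Rightarrow> 'o \<Rightarrow> 'o \<Rightarrow> 'm \<Rightarrow> 'm" where
  "arrow_of C X Y p = Ev C X Y \<cdot>\<^bsub>C\<^esub> pair C (Ident C X) (p \<cdot>\<^bsub>C\<^esub> bang C X)"

text \<open>The action of the functor \<open>Hom(1, -)\<close> on an arrow.\<close>

definition points_map :: "('o, 'm, 'r) ccc_scheme \<Rightarrow> 'm \<Rightarrow> 'm \<Rightarrow> 'm" where
  "points_map C f = (\<lambda>x \<in> hom C (One C) (Dom C f). f \<cdot>\<^bsub>C\<^esub> x)"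

definition points_faithful :: "('o, 'm, 'r) ccc_scheme \<Rightarrow> bool" where
  "points_faithful C \<longleftrightarrow> (\<forall>A \<in> Obj C. \<forall>B \<in> Obj C. inj_on (points_map C) (hom C A B))"

section \<open>Finite products and powers\<close>

text \<open>Factors are indexed by \<open>1, \<dots>, n\<close>. The product of a one-term family \<open>Y\<close> is \<open>Y 1\<close> itself and
  longer products are bracketed to the left, so that \<open>pow C X 1 = X\<close> and, for positive \<open>n\<close>,
  \<open>pow C X (Suc n) = Prod C (pow C X n) X\<close>.\<close>

fun fprod :: "('o, 'm, 'r) ccc_scheme \<Rightarrow> (nat \<Rightarrow> 'o) \<Rightarrow> nat \<Rightarrow> 'o" where
  "fprod C Y 0 = One C"
| "fprod C Y (Suc 0) = Y 1"
| "fprod C Y (Suc (Suc n)) = Prod C (fprod C Y (Suc n)) (Y (Suc (Suc n)))"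

fun proj :: "('o, 'm, 'r) ccc_scheme \<Rightarrow> (nat \<Rightarrow> 'o) \<Rightarrow> nat \<Rightarrow> nat \<Rightarrow> 'm" where
  "proj C Y 0 i = undefined"
| "proj C Y (Suc 0) i = Ident C (Y 1)"
| "proj C Y (Suc (Suc n)) i =
     (if i = Suc (Suc n) then Pr2 C (fprod C Y (Suc n)) (Y (Suc (Suc n)))
      else proj C Y (Suc n) i \<cdot>\<^bsub>C\<^esub> Pr1 C (fprod C Y (Suc n)) (Y (Suc (Suc n))))"

text \<open>\<open>tuple C W f n = (f 1, \<dots>, f n)\<close> for arrows \<open>f 1, \<dots>, f n\<close> with domain \<open>W\<close>.\<close>

fun tuple :: "('o, 'm, 'r) ccc_scheme \<Rightarrow> 'o \<Rightarrow> (nat \<Rightarrow> 'm) \<Rightarrow> nat \<Rightarrow> 'm" where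
  "tuple C W f 0 = bang C W"
| "tuple C W f (Suc 0) = f 1"
| "tuple C W f (Suc (Suc n)) = pair C (tuple C W f (Suc n)) (f (Suc (Suc n)))"

abbreviation pow :: "('o, 'm, 'r) ccc_scheme \<Rightarrow> 'o \<Rightarrow> nat \<Rightarrow> 'o" where
  "pow C X n \<equiv> fprod C (\<lambda>_. X) n"

abbreviation coord :: "('o, 'm, 'r) ccc_scheme \<Rightarrow> 'o \<Rightarrow> nat \<Rightarrow> nat \<Rightarrow> 'm" where
  "coord C X n i \<equiv> proj C (\<lambda>_. X) n i"

section \<open>Internal composition and automorphism objects\<close>

text \<open>\<open>icomp C X Y Z : Hom(X, Y) \<times> Hom(Y, Z) \<rightarrow> Hom(X, Z)\<close> lifts \<open>(\<alpha>, \<beta>) \<mapsto> \<beta> \<cdot> \<alpha>\<close>; it is the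
  transpose of \<open>(x, (\<alpha>, \<beta>)) \<mapsto> ev (ev (x, \<alpha>), \<beta>)\<close>.\<close>

definition icomp :: "('o, 'm, 'r) ccc_scheme \<Rightarrow> 'o \<Rightarrow> 'o \<Rightarrow> 'o \<Rightarrow> 'm" where
  "icomp C X Y Z =
    (let H = IHom C X Y; K = IHom C Y Z; P = Prod C H K;
         x = Pr1 C X P; \<alpha> = Pr1 C H K \<cdot>\<^bsub>C\<^esub> Pr2 C X P; \<beta> = Pr2 C H K \<cdot>\<^bsub>C\<^esub> Pr2 C X P
     in adj_transpose C X P (Ev C Y Z \<cdot>\<^bsub>C\<^esub> pair C (Ev C X Y \<cdot>\<^bsub>C\<^esub> pair C x \<alpha>) \<beta>))"

text \<open>\<open>nu C Y\<close> lifts \<open>(\<alpha>, \<beta>) \<mapsto> (\<beta> \<cdot> \<alpha>, \<alpha> \<cdot> \<beta>)\<close>, and \<open>iaut_incl\<close> is the first component of the pullback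
  projection \<open>Aut(Y) \<rightarrow> Hom(Y, Y) \<times> Hom(Y, Y)\<close>.\<close>

definition nu :: "('o, 'm, 'r) ccc_scheme \<Rightarrow> 'o \<Rightarrow> 'm" where
  "nu C Y = (let H = IHom C Y Y in
     pair C (icomp C Y Y Y) (icomp C Y Y Y \<cdot>\<^bsub>C\<^esub> pair C (Pr2 C H H) (Pr1 C H H)))"

definition id_point :: "('o, 'm, 'r) ccc_scheme \<Rightarrow> 'o \<Rightarrow> 'm" where
  "id_point C Y = pair C (point_of C (Ident C Y)) (point_of C (Ident C Y))"

definition iaut :: "('o, 'm, 'r) ccc_pb_scheme \<Rightarrow> 'o \<Rightarrow> 'o" where
  "iaut C Y = Pb C (nu C Y) (id_point C Y)"

definition iaut_incl :: "('o, 'm, 'r) ccc_pb_scheme \<Rightarrow> 'o \<Rightarrow> 'm" where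
  "iaut_incl C Y =
     Pr1 C (IHom C Y Y) (IHom C Y Y) \<cdot>\<^bsub>C\<^esub> Pb1 C (nu C Y) (id_point C Y)"

text \<open>The premise on \<open>\<zeta>\<close> says that the map \<open>Hom(1, Z) \<rightarrow> Hom(1, Hom(Y, Y)) \<cong> Hom(Y, Y)\<close> it induces
  has its values in the set of automorphisms of \<open>Y\<close>.\<close>

definition aut_detected_by_points :: "('o, 'm, 'r) ccc_pb_scheme \<Rightarrow> bool" where
  "aut_detected_by_points C \<longleftrightarrow>
     (\<forall>Y \<in> Obj C. \<forall>Z \<in> Obj C. \<forall>\<zeta> \<in> hom C Z (IHom C Y Y).
        (\<lambda>z. arrow_of C Y Y (points_map C \<zeta> z)) \<in> hom C (One C) Z \<rightarrow> automorphisms C Y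
        \<longrightarrow> factors_through C \<zeta> (iaut_incl C Y))"

section \<open>Latin hypercubes\<close>

text \<open>\<open>discard C X d s : X\<^sup>d\<^sup>+\<^sup>1 \<rightarrow> X\<^sup>d\<close> is the projection discarding coordinate \<open>s\<close>.\<close>

definition discard :: "('o, 'm, 'r) ccc_scheme \<Rightarrow> 'o \<Rightarrow> nat \<Rightarrow> nat \<Rightarrow> 'm" where
  "discard C X d s = tuple C (pow C X (Suc d))
     (\<lambda>k. coord C X (Suc d) (if k < s then k else Suc k)) d"

text \<open>The codomain of \<open>(pr\<^sub>1, ev)\<close> below is \<open>X\<^sup>d \<times> X = X\<^sup>d\<^sup>+\<^sup>1\<close>, as \<open>d\<close> is positive.\<close>

definition gamma_hat_component :: "('o, 'm, 'r) ccc_scheme \<Rightarrow> 'o \<Rightarrow> nat \<Rightarrow> nat \<Rightarrow> 'm" where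
  "gamma_hat_component C X d i = (let XD = pow C X d; H = IHom C XD X in
     adj_transpose C XD H (discard C X d i \<cdot>\<^bsub>C\<^esub> pair C (Pr1 C XD H) (Ev C XD X)))"

definition gamma_hat :: "('o, 'm, 'r) ccc_scheme \<Rightarrow> 'o \<Rightarrow> nat \<Rightarrow> 'm" where
  "gamma_hat C X d = tuple C (IHom C (pow C X d) X) (gamma_hat_component C X d) d"

definition iota_hat :: "('o, 'm, 'r) ccc_pb_scheme \<Rightarrow> 'o \<Rightarrow> nat \<Rightarrow> 'm" where
  "iota_hat C X d = (let A = (\<lambda>_. iaut C (pow C X d)) in
     tuple C (fprod C A d) (\<lambda>i. iaut_incl C (pow C X d) \<cdot>\<^bsub>C\<^esub> proj C A d i) d)"

definition latin :: "('o, 'm, 'r) ccc_pb_scheme \<Rightarrow> 'o \<Rightarrow> nat \<Rightarrow> 'o" where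
  "latin C X d = Pb C (gamma_hat C X d) (iota_hat C X d)"

definition latin_incl :: "('o, 'm, 'r) ccc_pb_scheme \<Rightarrow> 'o \<Rightarrow> nat \<Rightarrow> 'm" where
  "latin_incl C X d = Pb1 C (gamma_hat C X d) (iota_hat C X d)"

section \<open>The internal endomorphism operad\<close>

text \<open>The data of an operad in positive arities: the objects, the action of the permutations
  of \<open>{1..n}\<close> in arity \<open>n\<close>, the unit, and the partial compositions
  \<open>OpComp P d e i : OpObj P d \<times> OpObj P e \<rightarrow> OpObj P (d + e - 1)\<close> for \<open>i\<close> in \<open>{1..d}\<close>.\<close>

record ('o, 'm) operad =
  OpObj :: "nat \<Rightarrow> 'o"
  OpAct :: "nat \<Rightarrow> (nat \<Rightarrow> nat) \<Rightarrow> 'm"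
  OpUnit :: 'm
  OpComp :: "nat \<Rightarrow> nat \<Rightarrow> nat \<Rightarrow> 'm"

text \<open>\<open>permute_coords C X n \<sigma>\<close> is \<open>(x\<^sub>1, \<dots>, x\<^sub>n) \<mapsto> (x\<^bsub>\<sigma> 1\<^esub>, \<dots>, x\<^bsub>\<sigma> n\<^esub>)\<close>, and \<open>endo_act C X n \<sigma>\<close>
  lifts precomposition with it.\<close>

definition permute_coords :: "('o, 'm, 'r) ccc_scheme \<Rightarrow> 'o \<Rightarrow> nat \<Rightarrow> (nat \<Rightarrow> nat) \<Rightarrow> 'm" where
  "permute_coords C X n \<sigma> = tuple C (pow C X n) (\<lambda>k. coord C X n (\<sigma> k)) n"

definition endo_act :: "('o, 'm, 'r) ccc_scheme \<Rightarrow> 'o \<Rightarrow> nat \<Rightarrow> (nat \<Rightarrow> nat) \<Rightarrow> 'm" where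
  "endo_act C X n \<sigma> = (let XN = pow C X n; H = IHom C XN X in
     adj_transpose C XN H (Ev C XN X \<cdot>\<^bsub>C\<^esub> prod_map C (permute_coords C X n \<sigma>) (Ident C H)))"

text \<open>\<open>insert_op C X d e i : Hom(X\<^sup>e, X) \<rightarrow> Hom(X\<^sup>d\<^sup>+\<^sup>e\<^sup>-\<^sup>1, X\<^sup>d)\<close> lifts
  \<open>g \<mapsto> Id \<times> g \<times> Id\<close> with \<open>i - 1\<close> coordinates before and \<open>d - i\<close> after \<open>g\<close>; it is the transpose of
  \<open>(x, g) \<mapsto> (x\<^sub>1, \<dots>, x\<^bsub>i-1\<^esub>, ev ((x\<^sub>i, \<dots>, x\<^bsub>i+e-1\<^esub>), g), x\<^bsub>i+e\<^esub>, \<dots>, x\<^bsub>d+e-1\<^esub>)\<close>.\<close>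

definition insert_op :: "('o, 'm, 'r) ccc_scheme \<Rightarrow> 'o \<Rightarrow> nat \<Rightarrow> nat \<Rightarrow> nat \<Rightarrow> 'm" where
  "insert_op C X d e i =
    (let n = d + e - 1; XN = pow C X n; H = IHom C (pow C X e) X; W = Prod C XN H;
         x = (\<lambda>k. coord C X n k \<cdot>\<^bsub>C\<^esub> Pr1 C XN H);
         y = Ev C (pow C X e) X \<cdot>\<^bsub>C\<^esub> pair C (tuple C W (\<lambda>j. x (i + j - 1)) e) (Pr2 C XN H)
     in adj_transpose C XN H
          (tuple C W (\<lambda>k. if k < i then x k else if k = i then y else x (k + e - 1)) d))"

definition endo_comp :: "('o, 'm, 'r) ccc_scheme \<Rightarrow> 'o \<Rightarrow> nat \<Rightarrow> nat \<Rightarrow> nat \<Rightarrow> 'm" where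
  "endo_comp C X d e i = (let H = IHom C (pow C X d) X; K = IHom C (pow C X e) X in
     icomp C (pow C X (d + e - 1)) (pow C X d) X \<cdot>\<^bsub>C\<^esub>
       pair C (insert_op C X d e i \<cdot>\<^bsub>C\<^esub> Pr2 C H K) (Pr1 C H K))"

definition endo_operad :: "('o, 'm, 'r) ccc_scheme \<Rightarrow> 'o \<Rightarrow> ('o, 'm) operad" where
  "endo_operad C X = \<lparr>
     OpObj = (\<lambda>n. IHom C (pow C X n) X),
     OpAct = endo_act C X,
     OpUnit = point_of C (Ident C X),
     OpComp = endo_comp C X\<rparr>"

definition suboperad ::
    "('o, 'm, 'r) ccc_scheme \<Rightarrow> ('o, 'm) operad \<Rightarrow> (nat \<Rightarrow> 'o) \<Rightarrow> (nat \<Rightarrow> 'm) \<Rightarrow> bool" where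
  "suboperad C P L l \<longleftrightarrow>
     (\<forall>d \<ge> 1. L d \<in> Obj C \<and> l d \<in> hom C (L d) (OpObj P d) \<and> monic C (l d)) \<and>
     factors_through C (OpUnit P) (l 1) \<and>
     (\<forall>d \<ge> 1. \<forall>\<sigma>. \<sigma> permutes {1..d} \<longrightarrow>
        factors_through C (OpAct P d \<sigma> \<cdot>\<^bsub>C\<^esub> l d) (l d)) \<and>
     (\<forall>d \<ge> 1. \<forall>e \<ge> 1. \<forall>i \<in> {1..d}.
        factors_through C (OpComp P d e i \<cdot>\<^bsub>C\<^esub> prod_map C (l d) (l e)) (l (d + e - 1)))"

end

theory Submission
  imports Defs
begin

text \<open>Whether an arrow into \<open>Hom(X\<^sup>d, X)\<close> factors through the Latin object can be decided on
  points, and the points in question form an operad by an argument that imitates the one for Latin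
  hypercubes of sets.

  \<^bold>\<open>Monomorphisms.\<close> If \<open>Hom(1, -)\<close> is faithful, an arrow that is injective on points is a monomorphism
  (\<open>monic_if_injective_on_points\<close>). A point of \<open>Aut(Y)\<close> is a pair of mutually inverse arrows, hence
  is determined by its first component, so \<open>Aut(Y) \<rightarrow> Hom(Y, Y)\<close> is a monomorphism. A product of
  copies of it is one as well, and so is every pullback of that product, in particular the inclusion
  of the Latin object.

  \<^bold>\<open>Factorization.\<close> A point of the Latin object names an arrow \<open>f : X\<^sup>d \<rightarrow> X\<close> for which the
  maps "graph of \<open>f\<close>, followed by discarding coordinate \<open>i\<close>" are automorphisms for \<open>1 \<le> i \<le> d\<close>.
  Conversely, since automorphisms are detected on points, an arrow \<open>Z \<rightarrow> Hom(X\<^sup>d, X)\<close> all of whose points are of this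
  kind factors through \<open>Aut(X\<^sup>d)\<close> in each coordinate of \<open>gamma_hat\<close>, hence through the pullback
  (\<open>latin_incl_point\<close>, \<open>factors_through_latin_inclI\<close>).
  Each closure property of a suboperad thus becomes one about single arrows.

  \<^bold>\<open>Single arrows.\<close> By the Yoneda lemma, an arrow is invertible iff it is bijective on generalized
  elements \<open>W \<rightarrow> A\<close> for every \<open>W\<close>. For the maps above this says that the equation \<open>f(x\<^sub>1, \<dots>, x\<^sub>d) = y\<close>
  determines each \<open>x\<^sub>i\<close> uniquely from \<open>y\<close> and the other coordinates, for all generalized elements of
  \<open>X\<close> (\<open>latin_hypercube_iff_automorphisms\<close>). In this form the identity is clearly Latin and
  permuting coordinates preserves the condition. For a partial composite of \<open>f\<close> and \<open>g\<close>, a coordinate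
  outside the block fed into \<open>g\<close> is found by solving for one coordinate of \<open>f\<close>; a coordinate
  inside the block is found by first solving \<open>f\<close> for the value of \<open>g\<close> and then \<open>g\<close> for the coordinate
  (\<open>latin_hypercube_partial_comp\<close>).\<close>

section \<open>Calculus of generalized elements\<close>

context category
begin

lemma hom_objs: "f \<in> hom C A B \<Longrightarrow> A \<in> Obj C \<and> B \<in> Obj C"
  using dom_closed cod_closed by (auto simp: hom_def)

lemma dom_cod: "f \<in> hom C A B \<Longrightarrow> Dom C f = A" "f \<in> hom C A B \<Longrightarrow> Cod C f = B"
  by (auto simp: hom_def)

text \<open>The Yoneda lemma for isomorphisms: the inverse is the solution \<open>u\<close> for the universal element,
  \<open>W = A\<close> and \<open>t\<close> the identity.\<close>

lemma automorphism_iff_bijective_on_elements: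
  assumes h: "h \<in> hom C A A"
  shows "h \<in> automorphisms C A \<longleftrightarrow>
    (\<forall>W \<in> Obj C. \<forall>t \<in> hom C W A. \<exists>!u. u \<in> hom C W A \<and> h \<cdot> u = t)"
proof
  assume "h \<in> automorphisms C A"
  then obtain g where g: "g \<in> hom C A A" "g \<cdot> h = Ident C A" "h \<cdot> g = Ident C A"
    by (auto simp: automorphisms_def)
  show "\<forall>W \<in> Obj C. \<forall>t \<in> hom C W A. \<exists>!u. u \<in> hom C W A \<and> h \<cdot> u = t"
  proof (intro ballI)
    fix W t assume t: "t \<in> hom C W A"
    have "h \<cdot> (g \<cdot> t) = t"
      using comp_assoc[OF t g(1) h] g(3) id_comp[OF t] by simp
    moreover have "u = g \<cdot> t" if u: "u \<in> hom C W A" "h \<cdot> u = t" for u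
      using comp_assoc[OF u(1) h g(1)] g(2) id_comp[OF u(1)] u(2) by simp
    ultimately show "\<exists>!u. u \<in> hom C W A \<and> h \<cdot> u = t"
      using comp_closed[OF t g(1)] by blast
  qed
next
  assume bij: "\<forall>W \<in> Obj C. \<forall>t \<in> hom C W A. \<exists>!u. u \<in> hom C W A \<and> h \<cdot> u = t"
  have A: "A \<in> Obj C" using hom_objs[OF h] by simp
  note one = id_closed[OF A]
  obtain g where g: "g \<in> hom C A A" "h \<cdot> g = Ident C A"
    using bij A one by blast
  \<comment> \<open>The right inverse is a left inverse by injectivity: both sides below have the same image under \<open>h\<close>.\<close>
  have "h \<cdot> (g \<cdot> h) = h \<cdot> Ident C A"
    using comp_assoc[OF h g(1) h] g(2) id_comp[OF h] comp_id[OF h] by simp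
  then have "g \<cdot> h = Ident C A"
    using bij A h one comp_closed[OF h g(1)] comp_id[OF h] by metis
  then show "h \<in> automorphisms C A"
    using h g by (auto simp: automorphisms_def)
qed

end

context cartesian_closed_category
begin

lemma bang_closed: "W \<in> Obj C \<Longrightarrow> bang C W \<in> hom C W (One C)"
  unfolding bang_def by (rule theI') (rule terminal)

lemma bang_unique: "h \<in> hom C W (One C) \<Longrightarrow> h = bang C W"
  using terminal bang_closed hom_objs by blast

lemma bang_comp: "w \<in> hom C V W \<Longrightarrow> bang C W \<cdot> w = bang C V"
  by (meson bang_closed bang_unique comp_closed hom_objs)

lemma pair_spec:
  assumes "f \<in> hom C W A" "g \<in> hom C W B"
  shows "pair C f g \<in> hom C W (Prod C A B) \<and>
    Pr1 C A B \<cdot> pair C f g = f \<and> Pr2 C A B \<cdot> pair C f g = g"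
  using theI'[OF prod_universal[OF assms]] assms by (simp add: pair_def dom_cod)

lemma pair_closed: "\<lbrakk>f \<in> hom C W A; g \<in> hom C W B\<rbrakk> \<Longrightarrow> pair C f g \<in> hom C W (Prod C A B)"
  and pr1_pair: "\<lbrakk>f \<in> hom C W A; g \<in> hom C W B\<rbrakk> \<Longrightarrow> Pr1 C A B \<cdot> pair C f g = f"
  and pr2_pair: "\<lbrakk>f \<in> hom C W A; g \<in> hom C W B\<rbrakk> \<Longrightarrow> Pr2 C A B \<cdot> pair C f g = g"
  using pair_spec by auto

lemma prod_ext:
  assumes "u \<in> hom C W (Prod C A B)" "v \<in> hom C W (Prod C A B)" "A \<in> Obj C" "B \<in> Obj C"
    "Pr1 C A B \<cdot> u = Pr1 C A B \<cdot> v" "Pr2 C A B \<cdot> u = Pr2 C A B \<cdot> v"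
  shows "u = v"
  using prod_universal[OF comp_closed[OF assms(1) pr1_closed] comp_closed[OF assms(1) pr2_closed]]
    assms by metis

lemma pair_comp:
  assumes f: "f \<in> hom C W A" and g: "g \<in> hom C W B" and w: "w \<in> hom C V W"
  shows "pair C f g \<cdot> w = pair C (f \<cdot> w) (g \<cdot> w)"
proof -
  have AB: "A \<in> Obj C" "B \<in> Obj C" using hom_objs f g by auto
  note p = pair_closed[OF f g] and fw = comp_closed[OF w f] and gw = comp_closed[OF w g]
  show ?thesis
    by (rule prod_ext[OF comp_closed[OF w p] pair_closed[OF fw gw] AB])
      (simp_all add: comp_assoc[OF w p pr1_closed[OF AB], symmetric]
        comp_assoc[OF w p pr2_closed[OF AB], symmetric]
        pr1_pair[OF f g] pr2_pair[OF f g] pr1_pair[OF fw gw] pr2_pair[OF fw gw])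
qed

lemma prod_map_closed:
  assumes f: "f \<in> hom C A B" and g: "g \<in> hom C D E"
  shows "prod_map C f g \<in> hom C (Prod C A D) (Prod C B E)"
proof -
  have AD: "A \<in> Obj C" "D \<in> Obj C" using hom_objs f g by auto
  show ?thesis
    unfolding prod_map_def dom_cod(1)[OF f] dom_cod(1)[OF g]
    by (rule pair_closed[OF comp_closed[OF pr1_closed[OF AD] f] comp_closed[OF pr2_closed[OF AD] g]])
qed

lemma prod_map_pair:
  assumes f: "f \<in> hom C A B" and g: "g \<in> hom C D E"
    and a: "a \<in> hom C W A" and b: "b \<in> hom C W D"
  shows "prod_map C f g \<cdot> pair C a b = pair C (f \<cdot> a) (g \<cdot> b)"
proof -
  have AD: "A \<in> Obj C" "D \<in> Obj C" using hom_objs f g by auto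
  note p = pair_closed[OF a b] and p1 = pr1_closed[OF AD] and p2 = pr2_closed[OF AD]
  show ?thesis
    unfolding prod_map_def dom_cod(1)[OF f] dom_cod(1)[OF g]
      pair_comp[OF comp_closed[OF p1 f] comp_closed[OF p2 g] p]
      comp_assoc[OF p p1 f] comp_assoc[OF p p2 g] pr1_pair[OF a b] pr2_pair[OF a b] ..
qed

lemma adj_transpose_spec:
  assumes "A \<in> Obj C" "Z \<in> Obj C" "h \<in> hom C (Prod C A Z) B"
  shows "adj_transpose C A Z h \<in> hom C Z (IHom C A B) \<and>
    Ev C A B \<cdot> prod_map C (Ident C A) (adj_transpose C A Z h) = h"
  using theI'[OF ev_universal[OF assms]] by (simp add: adj_transpose_def dom_cod[OF assms(3)])

lemma adj_transpose_closed:
  assumes "A \<in> Obj C" "Z \<in> Obj C" "h \<in> hom C (Prod C A Z) B"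
  shows "adj_transpose C A Z h \<in> hom C Z (IHom C A B)"
  using adj_transpose_spec[OF assms] by simp

text \<open>The universal property of the transpose on generalized elements, \<open>ev(a, k(z)) = h(a, z)\<close>. All
  structural morphisms are transposes, so this rule is what computes them.\<close>

lemma ev_adj_transpose:
  assumes h: "h \<in> hom C (Prod C A Z) B" and a: "a \<in> hom C W A" and z: "z \<in> hom C W Z"
  shows "Ev C A B \<cdot> pair C a (adj_transpose C A Z h \<cdot> z) = h \<cdot> pair C a z"
proof -
  have obj: "A \<in> Obj C" "Z \<in> Obj C" "B \<in> Obj C" using hom_objs h a z by auto
  note k = adj_transpose_closed[OF obj(1,2) h] and i = id_closed[OF obj(1)]
  have "Ev C A B \<cdot> pair C a (adj_transpose C A Z h \<cdot> z)
      = Ev C A B \<cdot> (prod_map C (Ident C A) (adj_transpose C A Z h) \<cdot> pair C a z)"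
    using prod_map_pair[OF i k a z] id_comp[OF a] by simp
  also have "\<dots> = h \<cdot> pair C a z"
    using comp_assoc[OF pair_closed[OF a z] prod_map_closed[OF i k] ev_closed[OF obj(1,3)]]
      adj_transpose_spec[OF obj(1,2) h] by simp
  finally show ?thesis .
qed

lemma point_at:
  assumes "p \<in> hom C (One C) H" "W \<in> Obj C"
  shows "p \<cdot> bang C W \<in> hom C W H"
  using assms bang_closed comp_closed by blast

lemma arrow_of_closed:
  assumes "A \<in> Obj C" "B \<in> Obj C" "p \<in> hom C (One C) (IHom C A B)"
  shows "arrow_of C A B p \<in> hom C A B"
  unfolding arrow_of_def
  using comp_closed[OF pair_closed[OF id_closed point_at] ev_closed] assms by blast

text \<open>A point of \<open>Hom(A, B)\<close>, extended constantly along \<open>W \<rightarrow> 1\<close>, evaluates as the arrow it names.\<close>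

lemma ev_at_point:
  assumes B: "B \<in> Obj C" and p: "p \<in> hom C (One C) (IHom C A B)" and a: "a \<in> hom C W A"
  shows "Ev C A B \<cdot> pair C a (p \<cdot> bang C W) = arrow_of C A B p \<cdot> a"
proof -
  have obj: "A \<in> Obj C" "W \<in> Obj C" using hom_objs a by auto
  note i = id_closed[OF obj(1)] and pa = point_at[OF p obj(1)]
  have "arrow_of C A B p \<cdot> a = Ev C A B \<cdot> (pair C (Ident C A) (p \<cdot> bang C A) \<cdot> a)"
    unfolding arrow_of_def by (rule comp_assoc[OF a pair_closed[OF i pa] ev_closed[OF obj(1) B]])
  then show ?thesis
    using pair_comp[OF i pa a] id_comp[OF a] comp_assoc[OF a bang_closed[OF obj(1)] p]
      bang_comp[OF a] by simp
qed

text \<open>By \<open>ev_at_point\<close> on \<open>A \<times> 1\<close>, the arrow named by a point determines the arrow whose transpose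
  the point is.\<close>

lemma arrow_of_inj:
  assumes A: "A \<in> Obj C" and B: "B \<in> Obj C"
    and p: "p \<in> hom C (One C) (IHom C A B)" and q: "q \<in> hom C (One C) (IHom C A B)"
    and eq: "arrow_of C A B p = arrow_of C A B q"
  shows "p = q"
proof -
  note p1 = pr1_closed[OF A one_closed] and p2 = pr2_closed[OF A one_closed]
  have un: "Ev C A B \<cdot> prod_map C (Ident C A) r = arrow_of C A B r \<cdot> Pr1 C A (One C)"
    if r: "r \<in> hom C (One C) (IHom C A B)" for r
    using ev_at_point[OF B r p1] bang_unique[OF p2] id_comp[OF p1]
    by (simp add: prod_map_def dom_cod[OF r] dom_cod[OF id_closed[OF A]])
  have h: "arrow_of C A B q \<cdot> Pr1 C A (One C) \<in> hom C (Prod C A (One C)) B"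
    by (rule comp_closed[OF p1 arrow_of_closed[OF A B q]])
  show ?thesis
    using ev_universal[OF A one_closed h] un[OF p] un[OF q] p q eq by metis
qed

lemma arrow_of_adj_transpose:
  assumes h: "h \<in> hom C (Prod C A Z) B" and A: "A \<in> Obj C" and z: "z \<in> hom C (One C) Z"
  shows "arrow_of C A B (adj_transpose C A Z h \<cdot> z) = h \<cdot> pair C (Ident C A) (z \<cdot> bang C A)"
proof -
  have Z: "Z \<in> Obj C" using hom_objs z by auto
  show ?thesis
    unfolding arrow_of_def
      comp_assoc[OF bang_closed[OF A] z adj_transpose_closed[OF A Z h]]
    by (rule ev_adj_transpose[OF h id_closed[OF A] point_at[OF z A]])
qed

lemma point_of_closed:
  assumes f: "f \<in> hom C A B"
  shows "point_of C f \<in> hom C (One C) (IHom C A B)"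
proof -
  have A: "A \<in> Obj C" using hom_objs f by auto
  show ?thesis
    unfolding point_of_def dom_cod(1)[OF f]
    by (rule adj_transpose_closed[OF A one_closed comp_closed[OF pr1_closed[OF A one_closed] f]])
qed

lemma arrow_of_point_of:
  assumes f: "f \<in> hom C A B"
  shows "arrow_of C A B (point_of C f) = f"
proof -
  have A: "A \<in> Obj C" using hom_objs f by auto
  note p1 = pr1_closed[OF A one_closed] and o = id_closed[OF one_closed]
  note h = comp_closed[OF p1 f] and ia = id_closed[OF A]
  have c: "point_of C f \<cdot> Ident C (One C) = point_of C f"
    by (rule comp_id[OF point_of_closed[OF f]])
  show ?thesis
    using arrow_of_adj_transpose[OF h A o] c
      comp_assoc[OF pair_closed[OF ia point_at[OF o A]] p1 f]
      pr1_pair[OF ia point_at[OF o A]] comp_id[OF f]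
    by (simp add: point_of_def dom_cod[OF f])
qed

section \<open>Finite products\<close>

lemma fprod_closed: "\<forall>k \<in> {1..n}. Y k \<in> Obj C \<Longrightarrow> fprod C Y n \<in> Obj C"
  by (induction n rule: induct_nat_012) (auto simp: one_closed prod_closed)

lemma pow_closed: "X \<in> Obj C \<Longrightarrow> pow C X n \<in> Obj C"
  by (rule fprod_closed) simp

lemma tuple_closed:
  assumes "W \<in> Obj C" "\<And>k. k \<in> {1..n} \<Longrightarrow> f k \<in> hom C W (Y k)"
  shows "tuple C W f n \<in> hom C W (fprod C Y n)"
  using assms by (induction n rule: induct_nat_012) (auto simp: bang_closed pair_closed)

lemma tuple_cong: "(\<And>k. k \<in> {1..n} \<Longrightarrow> f k = g k) \<Longrightarrow> tuple C W f n = tuple C W g n"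
  by (induction n rule: induct_nat_012) auto

lemma proj_closed:
  assumes "\<forall>k \<in> {1..n}. Y k \<in> Obj C" "i \<in> {1..n}"
  shows "proj C Y n i \<in> hom C (fprod C Y n) (Y i)"
  using assms
proof (induction n rule: induct_nat_012)
  case (ge2 n)
  have "fprod C Y (Suc n) \<in> Obj C" "Y (Suc (Suc n)) \<in> Obj C"
    using ge2 by (auto intro!: fprod_closed)
  note p = pr1_closed[OF this] pr2_closed[OF this]
  have "proj C Y (Suc n) i \<in> hom C (fprod C Y (Suc n)) (Y i)" if "i \<noteq> Suc (Suc n)"
    using ge2 that by auto
  then show ?case using p comp_closed[OF p(1)] by auto
qed (auto simp: id_closed)

lemma coord_closed: "\<lbrakk>X \<in> Obj C; i \<in> {1..n}\<rbrakk> \<Longrightarrow> coord C X n i \<in> hom C (pow C X n) X"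
  using proj_closed[where Y = "\<lambda>_. X"] by simp

lemma proj_tuple:
  assumes "\<And>k. k \<in> {1..n} \<Longrightarrow> f k \<in> hom C W (Y k)" "i \<in> {1..n}"
  shows "proj C Y n i \<cdot> tuple C W f n = f i"
  using assms
proof (induction n rule: induct_nat_012)
  case 1
  then show ?case using id_comp[of "f 1" W "Y 1"] by simp
next
  case (ge2 n)
  let ?Z = "Y (Suc (Suc n))" and ?P = "fprod C Y (Suc n)"
  have g: "f (Suc (Suc n)) \<in> hom C W ?Z" using ge2.prems by simp
  then have W: "W \<in> Obj C" using hom_objs by blast
  have Y: "\<forall>k \<in> {1..Suc (Suc n)}. Y k \<in> Obj C" using ge2.prems(1) hom_objs by blast
  have t: "tuple C W f (Suc n) \<in> hom C W ?P"
    by (rule tuple_closed[OF W]) (use ge2.prems in auto)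
  have P: "?P \<in> Obj C" "?Z \<in> Obj C" using hom_objs g t by auto
  show ?case
  proof (cases "i = Suc (Suc n)")
    case True
    then show ?thesis using pr2_pair[OF t g] by simp
  next
    case False
    then have i: "i \<in> {1..Suc n}" using ge2.prems by auto
    have pi: "proj C Y (Suc n) i \<in> hom C ?P (Y i)"
      by (rule proj_closed[OF _ i]) (use Y in auto)
    have ih: "proj C Y (Suc n) i \<cdot> tuple C W f (Suc n) = f i"
      by (rule ge2.IH(2)) (use ge2.prems i in auto)
    show ?thesis
      using False comp_assoc[OF pair_closed[OF t g] pr1_closed[OF P] pi] pr1_pair[OF t g] ih
      by simp
  qed
qed auto

lemma fprod_ext:
  assumes "\<forall>k \<in> {1..n}. Y k \<in> Obj C"
    "u \<in> hom C W (fprod C Y n)" "v \<in> hom C W (fprod C Y n)"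
    "\<And>k. k \<in> {1..n} \<Longrightarrow> proj C Y n k \<cdot> u = proj C Y n k \<cdot> v"
  shows "u = v"
  using assms
proof (induction n arbitrary: u v rule: induct_nat_012)
  case 0
  then show ?case using bang_unique by (metis fprod.simps(1))
next
  case 1
  then show ?case using id_comp[of _ W "Y 1"] by simp
next
  case (ge2 n)
  let ?Z = "Y (Suc (Suc n))" and ?P = "fprod C Y (Suc n)"
  have P: "?P \<in> Obj C" "?Z \<in> Obj C" using ge2.prems by (auto intro!: fprod_closed)
  have u: "u \<in> hom C W (Prod C ?P ?Z)" and v: "v \<in> hom C W (Prod C ?P ?Z)"
    using ge2.prems by auto
  note p1 = pr1_closed[OF P]
  have "Pr1 C ?P ?Z \<cdot> u = Pr1 C ?P ?Z \<cdot> v"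
  proof (rule ge2.IH(2)[OF _ comp_closed[OF u p1] comp_closed[OF v p1]])
    fix k assume k: "k \<in> {1..Suc n}"
    have pk: "proj C Y (Suc n) k \<in> hom C ?P (Y k)"
      by (rule proj_closed[OF _ k]) (use ge2.prems in auto)
    show "proj C Y (Suc n) k \<cdot> (Pr1 C ?P ?Z \<cdot> u) = proj C Y (Suc n) k \<cdot> (Pr1 C ?P ?Z \<cdot> v)"
      using ge2.prems(4)[of k] k comp_assoc[OF u p1 pk] comp_assoc[OF v p1 pk] by auto
  qed (use ge2.prems in auto)
  moreover have "Pr2 C ?P ?Z \<cdot> u = Pr2 C ?P ?Z \<cdot> v"
    using ge2.prems(4)[of "Suc (Suc n)"] by auto
  ultimately show ?case by (rule prod_ext[OF u v P])
qed

lemma tuple_comp: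
  assumes "\<And>k. k \<in> {1..n} \<Longrightarrow> f k \<in> hom C W (Y k)" and w: "w \<in> hom C V W"
  shows "tuple C W f n \<cdot> w = tuple C V (\<lambda>k. f k \<cdot> w) n"
  using assms(1)
proof (induction n rule: induct_nat_012)
  case (ge2 n)
  have t: "tuple C W f (Suc n) \<in> hom C W (fprod C Y (Suc n))"
    by (rule tuple_closed) (use ge2.prems hom_objs[OF w] in auto)
  have g: "f (Suc (Suc n)) \<in> hom C W (Y (Suc (Suc n)))" using ge2.prems by simp
  show ?case using ge2.IH(2) ge2.prems pair_comp[OF t g w] by simp
qed (simp_all add: bang_comp[OF w])

lemma tuple_coords:
  assumes "\<forall>k \<in> {1..n}. Y k \<in> Obj C" "u \<in> hom C W (fprod C Y n)"
  shows "u = tuple C W (\<lambda>k. proj C Y n k \<cdot> u) n"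
proof (rule fprod_ext[OF assms])
  have t: "proj C Y n k \<cdot> u \<in> hom C W (Y k)" if "k \<in> {1..n}" for k
    using comp_closed[OF assms(2) proj_closed[OF assms(1) that]] .
  show "tuple C W (\<lambda>k. proj C Y n k \<cdot> u) n \<in> hom C W (fprod C Y n)"
    by (rule tuple_closed[OF _ t]) (use hom_objs[OF assms(2)] in simp)
  show "proj C Y n k \<cdot> u = proj C Y n k \<cdot> tuple C W (\<lambda>k. proj C Y n k \<cdot> u) n"
    if "k \<in> {1..n}" for k
    using proj_tuple[where Y = Y and f = "\<lambda>k. proj C Y n k \<cdot> u", OF t that] by simp
qed

text \<open>Generalized elements of a product correspond to families of generalized elements of the factors;
  this is injectivity, and \<open>tuple_coords\<close> is surjectivity.\<close>

lemma tuple_eq_iff: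
  assumes "\<And>k. k \<in> {1..n} \<Longrightarrow> f k \<in> hom C W (Y k)" "\<And>k. k \<in> {1..n} \<Longrightarrow> g k \<in> hom C W (Y k)"
  shows "tuple C W f n = tuple C W g n \<longleftrightarrow> (\<forall>k \<in> {1..n}. f k = g k)"
proof
  assume eq: "tuple C W f n = tuple C W g n"
  show "\<forall>k \<in> {1..n}. f k = g k"
  proof
    fix k assume k: "k \<in> {1..n}"
    show "f k = g k"
      using proj_tuple[where Y = Y and f = f, OF assms(1) k]
        proj_tuple[where Y = Y and f = g, OF assms(2) k] eq by simp
  qed
qed (rule tuple_cong, simp)

end

section \<open>Latin hypercubes on generalized elements\<close>

text \<open>The argument list of \<open>f\<close> in the \<open>i\<close>-th partial composite with an operation \<open>G\<close> of arity \<open>e\<close>: the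
  block \<open>x\<^sub>i, \<dots>, x\<^bsub>i+e-1\<^esub>\<close> is contracted to its value under \<open>G\<close>, which becomes entry \<open>i\<close>. The operation
  is kept abstract because it is applied both to elements, where \<open>G\<close> is composition with an arrow,
  and in the construction of the composition morphism, where \<open>G\<close> is an evaluation.\<close>

definition contract_block ::
    "nat \<Rightarrow> nat \<Rightarrow> ((nat \<Rightarrow> 'm) \<Rightarrow> 'm) \<Rightarrow> (nat \<Rightarrow> 'm) \<Rightarrow> nat \<Rightarrow> 'm" where
  "contract_block e i G x k =
     (if k < i then x k else if k = i then G (\<lambda>j. x (i + j - 1)) else x (k + e - 1))"

text \<open>The Latin property in the Yoneda form: every equation \<open>f(x\<^sub>1, \<dots>, x\<^sub>d) = y\<close> between generalized
  elements of \<open>X\<close> is uniquely solvable for \<open>x\<^sub>i\<close> once \<open>y\<close> and the other coordinates are given. The entry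
  \<open>x i\<close> is overwritten by the unknown.\<close>

definition latin_hypercube :: "('o, 'm, 'r) ccc_scheme \<Rightarrow> 'o \<Rightarrow> nat \<Rightarrow> 'm \<Rightarrow> bool" where
  "latin_hypercube C X d f \<longleftrightarrow> f \<in> hom C (pow C X d) X \<and>
     (\<forall>W \<in> Obj C. \<forall>x. (\<forall>k \<in> {1..d}. x k \<in> hom C W X) \<longrightarrow> (\<forall>i \<in> {1..d}. \<forall>y \<in> hom C W X.
        \<exists>!a. a \<in> hom C W X \<and> f \<cdot>\<^bsub>C\<^esub> tuple C W (x(i := a)) d = y))"

context cartesian_closed_category
begin

lemma latin_hypercube_unique_solution:
  assumes "latin_hypercube C X d f" "\<And>k. k \<in> {1..d} \<Longrightarrow> x k \<in> hom C W X"
    "i \<in> {1..d}" "y \<in> hom C W X"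
  shows "\<exists>!a. a \<in> hom C W X \<and> f \<cdot> tuple C W (x(i := a)) d = y"
proof -
  have "W \<in> Obj C" using hom_objs[OF assms(4)] by simp
  then show ?thesis using assms unfolding latin_hypercube_def by simp
qed

lemma tuple_in_pow:
  assumes "W \<in> Obj C" "\<And>k. k \<in> {1..n} \<Longrightarrow> x k \<in> hom C W X"
  shows "tuple C W x n \<in> hom C W (pow C X n)"
  using tuple_closed[where Y = "\<lambda>_. X"] assms by simp

lemma discard_closed: "X \<in> Obj C \<Longrightarrow> discard C X d i \<in> hom C (pow C X (Suc d)) (pow C X d)"
  unfolding discard_def by (intro tuple_in_pow pow_closed coord_closed) auto

lemma graph_closed:
  assumes "X \<in> Obj C" "1 \<le> d" "a \<in> hom C W (pow C X d)" "b \<in> hom C W X"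
  shows "pair C a b \<in> hom C W (pow C X (Suc d))"
  using pair_closed[OF assms(3,4)] assms(2) by (cases d) auto

lemma discard_tuple:
  assumes X: "X \<in> Obj C" and W: "W \<in> Obj C" and z: "\<And>k. k \<in> {1..Suc d} \<Longrightarrow> z k \<in> hom C W X"
  shows "discard C X d i \<cdot> tuple C W z (Suc d) = tuple C W (\<lambda>k. z (if k < i then k else Suc k)) d"
proof -
  note t = tuple_in_pow[OF W z]
  have "discard C X d i \<cdot> tuple C W z (Suc d) = tuple C W
      (\<lambda>k. coord C X (Suc d) (if k < i then k else Suc k) \<cdot> tuple C W z (Suc d)) d"
    unfolding discard_def
    by (rule tuple_comp[where Y = "\<lambda>_. X", OF coord_closed[OF X] t]) auto
  also have "\<dots> = tuple C W (\<lambda>k. z (if k < i then k else Suc k)) d"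
    by (rule tuple_cong, rule proj_tuple[where Y = "\<lambda>_. X"]) (use z in auto)
  finally show ?thesis .
qed

lemma pair_tuple:
  assumes "1 \<le> d"
  shows "pair C (tuple C W u d) b = tuple C W (u(Suc d := b)) (Suc d)"
proof -
  have "tuple C W (u(Suc d := b)) d = tuple C W u d" by (rule tuple_cong) simp
  then show ?thesis using assms by (cases d) auto
qed

text \<open>Targets of the map \<open>u \<mapsto> (u\<^sub>1, \<dots>, u\<^bsub>i-1\<^esub>, u\<^bsub>i+1\<^esub>, \<dots>, u\<^sub>d, f(u))\<close> are parametrized redundantly by
  a full family \<open>x\<close> together with \<open>y\<close>, the entry \<open>x i\<close> being dropped. This turns the reindexing
  caused by discarding a coordinate into a plain comparison away from \<open>i\<close>.\<close>

lemma discard_graph_eq_iff: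
  assumes X: "X \<in> Obj C" and d: "1 \<le> d" and f: "f \<in> hom C (pow C X d) X"
    and u: "\<And>k. k \<in> {1..d} \<Longrightarrow> u k \<in> hom C W X"
    and x: "\<And>k. k \<in> {1..d} \<Longrightarrow> x k \<in> hom C W X" and y: "y \<in> hom C W X" and i: "i \<in> {1..d}"
  shows "(discard C X d i \<cdot> pair C (Ident C (pow C X d)) f) \<cdot> tuple C W u d =
      tuple C W (\<lambda>k. (x(Suc d := y)) (if k < i then k else Suc k)) d \<longleftrightarrow>
    (\<forall>k \<in> {1..d} - {i}. u k = x k) \<and> f \<cdot> tuple C W u d = y"
proof -
  have W: "W \<in> Obj C" using hom_objs y by auto
  note t = tuple_in_pow[OF W u] and I = id_closed[OF pow_closed[OF X]]
  let ?y = "f \<cdot> tuple C W u d"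
  have y': "?y \<in> hom C W X" by (rule comp_closed[OF t f])
  have "(discard C X d i \<cdot> pair C (Ident C (pow C X d)) f) \<cdot> tuple C W u d =
      discard C X d i \<cdot> (pair C (Ident C (pow C X d)) f \<cdot> tuple C W u d)"
    by (rule comp_assoc[OF t graph_closed[OF X d I f] discard_closed[OF X]])
  also have "pair C (Ident C (pow C X d)) f \<cdot> tuple C W u d = pair C (tuple C W u d) ?y"
    using pair_comp[OF I f t] id_comp[OF t] by simp
  also have "\<dots> = tuple C W (u(Suc d := ?y)) (Suc d)"
    by (rule pair_tuple[OF d])
  also have "discard C X d i \<cdot> \<dots> =
      tuple C W (\<lambda>k. (u(Suc d := ?y)) (if k < i then k else Suc k)) d"
    by (rule discard_tuple[OF X W]) (use u y' in auto)
  finally have "(discard C X d i \<cdot> pair C (Ident C (pow C X d)) f) \<cdot> tuple C W u d =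
      tuple C W (\<lambda>k. (x(Suc d := y)) (if k < i then k else Suc k)) d \<longleftrightarrow>
      tuple C W (\<lambda>k. (u(Suc d := ?y)) (if k < i then k else Suc k)) d =
      tuple C W (\<lambda>k. (x(Suc d := y)) (if k < i then k else Suc k)) d" by simp
  also have "\<dots> \<longleftrightarrow> (\<forall>k \<in> {1..d}. (u(Suc d := ?y)) (if k < i then k else Suc k) =
      (x(Suc d := y)) (if k < i then k else Suc k))"
    by (rule tuple_eq_iff[where Y = "\<lambda>_. X"]) (use u y' x y in auto)
  also have "\<dots> \<longleftrightarrow> (\<forall>k \<in> {1..Suc d} - {i}. (u(Suc d := ?y)) k = (x(Suc d := y)) k)"
  proof -
    \<comment> \<open>The reindexing enumerates all positions except \<open>i\<close>.\<close>
    let ?s = "\<lambda>k. if k < i then k else Suc k"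
    have range: "?s ` {1..d} = {1..Suc d} - {i}"
    proof (intro equalityI subsetI)
      fix k assume k: "k \<in> {1..Suc d} - {i}"
      show "k \<in> ?s ` {1..d}"
        by (rule image_eqI[of _ _ "if k < i then k else k - 1"]) (use k i in auto)
    qed (use i in auto)
    show ?thesis unfolding range[symmetric] by (rule ball_simps(9)[symmetric])
  qed
  also have "\<dots> \<longleftrightarrow> (\<forall>k \<in> {1..d} - {i}. u k = x k) \<and> ?y = y"
  proof -
    have "{1..Suc d} - {i} = insert (Suc d) ({1..d} - {i})" using i by auto
    then show ?thesis by auto
  qed
  finally show ?thesis .
qed

text \<open>Bijectivity on elements, read off coordinatewise: a preimage of the target given by \<open>(x, y)\<close>
  must agree with \<open>x\<close> away from \<open>i\<close>, so preimages correspond to solutions for the remaining coordinate.\<close>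

lemma discard_graph_automorphism_iff:
  assumes X: "X \<in> Obj C" and d: "1 \<le> d" and f: "f \<in> hom C (pow C X d) X" and i: "i \<in> {1..d}"
  shows "discard C X d i \<cdot> pair C (Ident C (pow C X d)) f \<in> automorphisms C (pow C X d) \<longleftrightarrow>
    (\<forall>W \<in> Obj C. \<forall>x. (\<forall>k \<in> {1..d}. x k \<in> hom C W X) \<longrightarrow> (\<forall>y \<in> hom C W X.
        \<exists>!a. a \<in> hom C W X \<and> f \<cdot> tuple C W (x(i := a)) d = y))"
    (is "?h \<in> _ \<longleftrightarrow> ?latin")
proof -
  let ?P = "pow C X d"
  let ?t = "\<lambda>W x y. tuple C W (\<lambda>k. (x(Suc d := y)) (if k < i then k else Suc k)) d"
  note D = pow_closed[OF X, of d]
  have h: "?h \<in> hom C ?P ?P"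
    by (rule comp_closed[OF graph_closed[OF X d id_closed[OF D] f] discard_closed[OF X]])
  have coords: "\<exists>u. (\<forall>k \<in> {1..d}. u k \<in> hom C W X) \<and> t = tuple C W u d"
    if t: "t \<in> hom C W ?P" for t W
  proof (intro exI conjI ballI)
    show "t = tuple C W (\<lambda>k. coord C X d k \<cdot> t) d"
      by (rule tuple_coords[OF _ t]) (simp add: X)
  qed (rule comp_closed[OF t coord_closed[OF X]])
  have target: "\<exists>x y. (\<forall>k \<in> {1..d}. x k \<in> hom C W X) \<and> y \<in> hom C W X \<and> t = ?t W x y"
    if "t \<in> hom C W ?P" for t W
  proof -
    obtain u where u: "\<forall>k \<in> {1..d}. u k \<in> hom C W X" "t = tuple C W u d"
      using coords[OF \<open>t \<in> hom C W ?P\<close>] by blast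
    \<comment> \<open>Position \<open>i\<close> is free; \<open>1\<close> is merely some index at which \<open>u\<close> is an element of \<open>X\<close>.\<close>
    let ?r = "\<lambda>k. if k < i then k else if k = i then 1 else k - 1"
    let ?x = "\<lambda>k. u (?r k)"
    have "t = ?t W ?x (u d)"
      unfolding u(2) by (rule tuple_cong) (use i in auto)
    moreover have "\<forall>k \<in> {1..d}. ?x k \<in> hom C W X"
    proof
      fix k assume "k \<in> {1..d}"
      then have "?r k \<in> {1..d}" using i by auto
      then show "?x k \<in> hom C W X" using u(1) by blast
    qed
    moreover have "u d \<in> hom C W X" using u(1) d by simp
    ultimately show ?thesis by (intro exI[of _ ?x] exI[of _ "u d"] conjI)
  qed
  have ex1: "(\<exists>!v. v \<in> hom C W ?P \<and> ?h \<cdot> v = ?t W x y) \<longleftrightarrow>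
      (\<exists>!a. a \<in> hom C W X \<and> f \<cdot> tuple C W (x(i := a)) d = y)" (is "?L \<longleftrightarrow> ?R")
    if W: "W \<in> Obj C" and x: "\<forall>k \<in> {1..d}. x k \<in> hom C W X" and y: "y \<in> hom C W X" for W x y
  proof -
    have upd: "\<And>k. k \<in> {1..d} \<Longrightarrow> (x(i := a)) k \<in> hom C W X" if "a \<in> hom C W X" for a
      using x that by simp
    have sol: "v \<in> hom C W ?P \<and> ?h \<cdot> v = ?t W x y \<longleftrightarrow>
        (\<exists>a \<in> hom C W X. v = tuple C W (x(i := a)) d \<and> f \<cdot> tuple C W (x(i := a)) d = y)" for v
    proof
      assume v: "v \<in> hom C W ?P \<and> ?h \<cdot> v = ?t W x y"
      then obtain u where u: "\<forall>k \<in> {1..d}. u k \<in> hom C W X" "v = tuple C W u d"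
        using coords by blast
      have "(\<forall>k \<in> {1..d} - {i}. u k = x k) \<and> f \<cdot> tuple C W u d = y"
        using discard_graph_eq_iff[OF X d f _ _ y i, where u = u and x = x] u x v by simp
      moreover from this have "tuple C W u d = tuple C W (x(i := u i)) d"
        by (intro tuple_cong) auto
      ultimately show "\<exists>a \<in> hom C W X. v = tuple C W (x(i := a)) d \<and>
          f \<cdot> tuple C W (x(i := a)) d = y"
        using u i by auto
    next
      assume "\<exists>a \<in> hom C W X. v = tuple C W (x(i := a)) d \<and> f \<cdot> tuple C W (x(i := a)) d = y"
      then obtain a where a: "a \<in> hom C W X" "v = tuple C W (x(i := a)) d"
          "f \<cdot> tuple C W (x(i := a)) d = y" by blast
      then show "v \<in> hom C W ?P \<and> ?h \<cdot> v = ?t W x y"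
        using discard_graph_eq_iff[where u = "x(i := a)" and x = x, OF X d f upd[OF a(1)] _ y i]
          tuple_in_pow[where x = "x(i := a)", OF W upd[OF a(1)]] x by simp
    qed
    have inj: "a = b" if "a \<in> hom C W X" "b \<in> hom C W X"
        "tuple C W (x(i := a)) d = tuple C W (x(i := b)) d" for a b
    proof -
      have "\<forall>k \<in> {1..d}. (x(i := a)) k = (x(i := b)) k"
        using that(3) by (subst (asm) tuple_eq_iff[where Y = "\<lambda>_. X"])
          (use upd[OF that(1)] upd[OF that(2)] in blast)+
      then show ?thesis using i by (metis fun_upd_same)
    qed
    show ?thesis unfolding sol using inj by blast
  qed
  have t_closed: "?t W x y \<in> hom C W ?P"
    if "W \<in> Obj C" "\<forall>k \<in> {1..d}. x k \<in> hom C W X" "y \<in> hom C W X" for W x y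
    by (rule tuple_in_pow) (use that in auto)
  show ?thesis
    unfolding automorphism_iff_bijective_on_elements[OF h]
  proof (intro iffI ballI allI impI)
    fix W x y
    assume "\<forall>W \<in> Obj C. \<forall>t \<in> hom C W ?P. \<exists>!u. u \<in> hom C W ?P \<and> ?h \<cdot> u = t"
      and *: "W \<in> Obj C" "\<forall>k \<in> {1..d}. x k \<in> hom C W X" "y \<in> hom C W X"
    then show "\<exists>!a. a \<in> hom C W X \<and> f \<cdot> tuple C W (x(i := a)) d = y"
      using ex1[OF *] t_closed[OF *] by blast
  next
    fix W t assume l: ?latin and W: "W \<in> Obj C" and "t \<in> hom C W ?P"
    then obtain x y where *: "\<forall>k \<in> {1..d}. x k \<in> hom C W X" "y \<in> hom C W X" "t = ?t W x y"
      using target by blast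
    show "\<exists>!u. u \<in> hom C W ?P \<and> ?h \<cdot> u = t"
      unfolding *(3) ex1[OF W *(1,2)] using l W *(1,2) by blast
  qed
qed

lemma latin_hypercube_iff_automorphisms:
  assumes X: "X \<in> Obj C" and d: "1 \<le> d" and f: "f \<in> hom C (pow C X d) X"
  shows "latin_hypercube C X d f \<longleftrightarrow>
    (\<forall>i \<in> {1..d}. discard C X d i \<cdot> pair C (Ident C (pow C X d)) f
       \<in> automorphisms C (pow C X d))"
    (is "_ \<longleftrightarrow> ?aut")
proof -
  have "?aut \<longleftrightarrow> (\<forall>i \<in> {1..d}. \<forall>W \<in> Obj C. \<forall>x. (\<forall>k \<in> {1..d}. x k \<in> hom C W X) \<longrightarrow>
      (\<forall>y \<in> hom C W X. \<exists>!a. a \<in> hom C W X \<and> f \<cdot> tuple C W (x(i := a)) d = y))"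
    by (rule ball_cong[OF refl]) (rule discard_graph_automorphism_iff[OF X d f])
  then show ?thesis
    unfolding latin_hypercube_def by (intro iffI conjI f ballI allI impI) simp_all
qed

lemma latin_hypercube_ident:
  assumes X: "X \<in> Obj C"
  shows "latin_hypercube C X 1 (Ident C X)"
  using id_closed[OF X] id_comp by (auto simp: latin_hypercube_def)

lemma permute_coords_closed:
  assumes "X \<in> Obj C" "\<sigma> permutes {1..n}"
  shows "permute_coords C X n \<sigma> \<in> hom C (pow C X n) (pow C X n)"
  unfolding permute_coords_def
  by (intro tuple_in_pow pow_closed coord_closed assms(1))
    (simp only: permutes_in_image[OF assms(2)])

lemma permute_coords_tuple:
  assumes X: "X \<in> Obj C" and s: "\<sigma> permutes {1..n}" and W: "W \<in> Obj C"
    and x: "\<And>k. k \<in> {1..n} \<Longrightarrow> x k \<in> hom C W X"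
  shows "permute_coords C X n \<sigma> \<cdot> tuple C W x n = tuple C W (x \<circ> \<sigma>) n"
proof -
  have s': "\<sigma> k \<in> {1..n}" if "k \<in> {1..n}" for k using permutes_in_image[OF s] that by blast
  have "permute_coords C X n \<sigma> \<cdot> tuple C W x n =
      tuple C W (\<lambda>k. coord C X n (\<sigma> k) \<cdot> tuple C W x n) n"
    unfolding permute_coords_def
    by (rule tuple_comp[where Y = "\<lambda>_. X", OF coord_closed[OF X s'] tuple_in_pow[OF W x]])
  also have "\<dots> = tuple C W (x \<circ> \<sigma>) n"
    using proj_tuple[where Y = "\<lambda>_. X", OF x s'] by (intro tuple_cong) simp
  finally show ?thesis .
qed

text \<open>Solving for \<open>x\<^sub>i\<close> after the permutation is solving \<open>f\<close> for the coordinate at which \<open>x\<^sub>i\<close> is inserted,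
  which is the one numbered by the preimage of \<open>i\<close>.\<close>

lemma latin_hypercube_permute:
  assumes X: "X \<in> Obj C" and s: "\<sigma> permutes {1..n}" and f: "latin_hypercube C X n f"
  shows "latin_hypercube C X n (f \<cdot> permute_coords C X n \<sigma>)"
proof -
  have fh: "f \<in> hom C (pow C X n) X" using f by (simp add: latin_hypercube_def)
  note p = permute_coords_closed[OF X s]
  have "\<exists>!a. a \<in> hom C W X \<and> (f \<cdot> permute_coords C X n \<sigma>) \<cdot> tuple C W (x(i := a)) n = y"
    if W: "W \<in> Obj C" and x: "\<forall>k \<in> {1..n}. x k \<in> hom C W X" and i: "i \<in> {1..n}"
      and y: "y \<in> hom C W X" for W x i y
  proof -
    let ?j = "inv \<sigma> i"
    have upd: "x(i := a) \<circ> \<sigma> = (x \<circ> \<sigma>)(?j := a)" for a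
    proof
      fix k
      have "\<sigma> k = i \<longleftrightarrow> k = ?j" using permutes_inv_eq[OF s, of i k] by auto
      then show "(x(i := a) \<circ> \<sigma>) k = ((x \<circ> \<sigma>)(?j := a)) k" by simp
    qed
    have eq: "(f \<cdot> permute_coords C X n \<sigma>) \<cdot> tuple C W (x(i := a)) n =
        f \<cdot> tuple C W ((x \<circ> \<sigma>)(?j := a)) n" if a: "a \<in> hom C W X" for a
    proof -
      have xa: "\<And>k. k \<in> {1..n} \<Longrightarrow> (x(i := a)) k \<in> hom C W X" using x a by simp
      show ?thesis
        using comp_assoc[OF tuple_in_pow[where x = "x(i := a)", OF W xa] p fh]
          permute_coords_tuple[where x = "x(i := a)", OF X s W xa]
        by (simp only: upd)
    qed
    have "\<exists>!a. a \<in> hom C W X \<and> f \<cdot> tuple C W ((x \<circ> \<sigma>)(?j := a)) n = y"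
    proof (rule latin_hypercube_unique_solution[OF f _ _ y])
      show "(x \<circ> \<sigma>) k \<in> hom C W X" if "k \<in> {1..n}" for k
        using x that permutes_in_image[OF s, of k] by simp
      show "?j \<in> {1..n}" using permutes_in_image[OF permutes_inv[OF s], of i] i by simp
    qed
    then show ?thesis using eq by (simp cong: conj_cong)
  qed
  then show ?thesis
    using comp_closed[OF p fh] unfolding latin_hypercube_def by blast
qed

lemma contract_block_in:
  assumes "i \<in> {1..d}" "1 \<le> e" "\<And>m. m \<in> {1..d + e - 1} \<Longrightarrow> x m \<in> S"
    "G (\<lambda>j. x (i + j - 1)) \<in> S" "k \<in> {1..d}"
  shows "contract_block e i G x k \<in> S"
proof -
  have "k < i \<Longrightarrow> k \<in> {1..d + e - 1}" "\<not> k < i \<Longrightarrow> k \<noteq> i \<Longrightarrow> k + e - 1 \<in> {1..d + e - 1}"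
    using assms by auto
  then show ?thesis using assms(3)[of k] assms(3)[of "k + e - 1"] assms(4)
    by (simp add: contract_block_def)
qed

text \<open>Changing \<open>x\<^sub>k\<close> changes exactly one entry of the contracted family. Outside the block that entry is
  \<open>x\<^sub>k\<close> itself, up to renumbering, and \<open>f\<close> is solved for it. Inside the block it is the value of \<open>g\<close>,
  and \<open>f\<close> and \<open>g\<close> are solved one after the other. The composite \<open>h\<close> enters only through its effect on
  tuples, so that no particular expression for it has to be manipulated.\<close>

lemma latin_hypercube_partial_comp:
  assumes X: "X \<in> Obj C" and d: "1 \<le> d" and e: "1 \<le> e" and i: "i \<in> {1..d}"
    and f: "latin_hypercube C X d f" and g: "latin_hypercube C X e g"
    and h: "h \<in> hom C (pow C X (d + e - 1)) X"
    and h_tuple: "\<And>W x. \<lbrakk>W \<in> Obj C; \<And>k. k \<in> {1..d + e - 1} \<Longrightarrow> x k \<in> hom C W X\<rbrakk> \<Longrightarrow>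
      h \<cdot> tuple C W x (d + e - 1) = f \<cdot> tuple C W (contract_block e i (\<lambda>b. g \<cdot> tuple C W b e) x) d"
  shows "latin_hypercube C X (d + e - 1) h"
proof -
  let ?n = "d + e - 1"
  have gh: "g \<in> hom C (pow C X e) X" using g by (simp add: latin_hypercube_def)
  have "\<exists>!a. a \<in> hom C W X \<and> h \<cdot> tuple C W (x(k := a)) ?n = y"
    if W: "W \<in> Obj C" and x: "\<forall>k \<in> {1..?n}. x k \<in> hom C W X" and k: "k \<in> {1..?n}"
      and y: "y \<in> hom C W X" for W x k y
  proof -
    let ?G = "\<lambda>b. g \<cdot> tuple C W b e" and ?b = "\<lambda>j. x (i + j - 1)"
    let ?c = "contract_block e i ?G"
    have G: "?G b \<in> hom C W X" if "\<And>j. j \<in> {1..e} \<Longrightarrow> b j \<in> hom C W X" for b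
      by (rule comp_closed[OF tuple_in_pow[OF W that] gh])
    have b: "?b j \<in> hom C W X" if "j \<in> {1..e}" for j
    proof -
      have "i + j - 1 \<in> {1..?n}" using that i by auto
      then show ?thesis by (rule x[rule_format])
    qed
    have c: "?c x j \<in> hom C W X" if "j \<in> {1..d}" for j
      by (rule contract_block_in[where G = ?G and x = x, OF i e _ G that]) (use x b in auto)
    have hx: "h \<cdot> tuple C W (x(k := a)) ?n = f \<cdot> tuple C W (?c (x(k := a))) d"
      if "a \<in> hom C W X" for a
      by (rule h_tuple[OF W]) (use x that in auto)
    have outside: ?thesis
      if j: "j \<in> {1..d}" and cu: "\<And>a. \<forall>m \<in> {1..d}. ?c (x(k := a)) m = ((?c x)(j := a)) m" for j
    proof -
      have "tuple C W (?c (x(k := a))) d = tuple C W ((?c x)(j := a)) d" for a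
        by (rule tuple_cong) (rule cu[rule_format])
      then have "h \<cdot> tuple C W (x(k := a)) ?n = f \<cdot> tuple C W ((?c x)(j := a)) d"
        if "a \<in> hom C W X" for a
        using hx[OF that] by simp
      then show ?thesis
        using latin_hypercube_unique_solution[where x = "?c x", OF f c j y]
        by (simp cong: conj_cong)
    qed
    consider "k < i" | "i \<le> k" "k < i + e" | "i + e \<le> k" by linarith
    then show ?thesis
    proof cases
      case 1
      have "?G (\<lambda>j. (x(k := a)) (i + j - 1)) = ?G ?b" for a
      proof -
        have "tuple C W (\<lambda>j. (x(k := a)) (i + j - 1)) e = tuple C W ?b e"
          by (rule tuple_cong) (use 1 in auto)
        then show ?thesis by simp
      qed
      then show ?thesis
        by (intro outside[of k]) (use 1 i k in \<open>auto simp: contract_block_def\<close>)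
    next
      case 3
      have "?G (\<lambda>j. (x(k := a)) (i + j - 1)) = ?G ?b" for a
      proof -
        have "tuple C W (\<lambda>j. (x(k := a)) (i + j - 1)) e = tuple C W ?b e"
          by (rule tuple_cong) (use 3 in auto)
        then show ?thesis by simp
      qed
      then show ?thesis
        by (intro outside[of "k + 1 - e"]) (use 3 i k e in \<open>auto simp: contract_block_def\<close>)
    next
      case 2
      let ?j = "k + 1 - i"
      have j: "?j \<in> {1..e}" using 2 by auto
      have Gu: "?G (\<lambda>j. (x(k := a)) (i + j - 1)) = ?G (?b(?j := a))" for a
      proof -
        have "tuple C W (\<lambda>j. (x(k := a)) (i + j - 1)) e = tuple C W (?b(?j := a)) e"
          by (rule tuple_cong) (use 2 i in auto)
        then show ?thesis by simp
      qed
      have cu: "tuple C W (?c (x(k := a))) d = tuple C W ((?c x)(i := ?G (?b(?j := a)))) d" for a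
        by (rule tuple_cong) (use 2 i Gu in \<open>auto simp: contract_block_def\<close>)
      have Gc: "?G (?b(?j := a)) \<in> hom C W X" if "a \<in> hom C W X" for a
      proof (rule G)
        fix j assume "j \<in> {1..e}"
        then have "?b j \<in> hom C W X" by (rule b)
        then show "(?b(?j := a)) j \<in> hom C W X" using that by simp
      qed
      \<comment> \<open>The value that \<open>g\<close> must take on its block.\<close>
      obtain m where m: "m \<in> hom C W X" "f \<cdot> tuple C W ((?c x)(i := m)) d = y"
          "\<And>m'. m' \<in> hom C W X \<Longrightarrow> f \<cdot> tuple C W ((?c x)(i := m')) d = y \<Longrightarrow> m' = m"
        using latin_hypercube_unique_solution[where x = "?c x", OF f c i y] by blast
      have "\<exists>!a. a \<in> hom C W X \<and> ?G (?b(?j := a)) = m"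
        by (rule latin_hypercube_unique_solution[where x = ?b, OF g b j m(1)])
      moreover have "h \<cdot> tuple C W (x(k := a)) ?n = y \<longleftrightarrow> ?G (?b(?j := a)) = m"
        if "a \<in> hom C W X" for a
        unfolding hx[OF that] cu
      proof
        assume "f \<cdot> tuple C W ((?c x)(i := ?G (?b(?j := a)))) d = y"
        then show "?G (?b(?j := a)) = m" by (rule m(3)[OF Gc[OF that]])
      qed (simp only: m(2))
      ultimately show ?thesis by (simp cong: conj_cong)
    qed
  qed
  then show ?thesis using h unfolding latin_hypercube_def by blast
qed

section \<open>Pointwise description of the operad structure\<close>

lemma coord_pair:
  assumes X: "X \<in> Obj C" and a: "a \<in> hom C W (pow C X n)" and b: "b \<in> hom C W H"
    and k: "k \<in> {1..n}"
  shows "(coord C X n k \<cdot> Pr1 C (pow C X n) H) \<cdot> pair C a b = coord C X n k \<cdot> a"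
proof -
  have H: "H \<in> Obj C" using hom_objs[OF b] by simp
  show ?thesis
    using comp_assoc[OF pair_closed[OF a b] pr1_closed[OF pow_closed[OF X] H] coord_closed[OF X k]]
      pr1_pair[OF a b] by simp
qed

text \<open>The arrow \<open>h\<close> is the one of which internal composition is the transpose.\<close>

lemma icomp_body:
  fixes X Y Z
  defines "P \<equiv> Prod C (IHom C X Y) (IHom C Y Z)"
  defines "h \<equiv> Ev C Y Z \<cdot> pair C
    (Ev C X Y \<cdot> pair C (Pr1 C X P) (Pr1 C (IHom C X Y) (IHom C Y Z) \<cdot> Pr2 C X P))
    (Pr2 C (IHom C X Y) (IHom C Y Z) \<cdot> Pr2 C X P)"
  assumes obj: "X \<in> Obj C" "Y \<in> Obj C" "Z \<in> Obj C"
  shows icomp_body_closed: "h \<in> hom C (Prod C X P) Z"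
    and icomp_body_pair: "\<lbrakk>a \<in> hom C W X; b \<in> hom C W (IHom C X Y); c \<in> hom C W (IHom C Y Z)\<rbrakk>
      \<Longrightarrow> h \<cdot> pair C a (pair C b c) = Ev C Y Z \<cdot> pair C (Ev C X Y \<cdot> pair C a b) c"
proof -
  note H = ihom_closed[OF obj(1,2)] and K = ihom_closed[OF obj(2,3)]
  have P: "P \<in> Obj C" unfolding P_def by (rule prod_closed[OF H K])
  note p1 = pr1_closed[OF obj(1) P] and p2 = pr2_closed[OF obj(1) P]
  note q1 = pr1_closed[OF H K, folded P_def] and q2 = pr2_closed[OF H K, folded P_def]
  note q1p = comp_closed[OF p2 q1] and q2p = comp_closed[OF p2 q2]
  note e1 = ev_closed[OF obj(1,2)] and e2 = ev_closed[OF obj(2,3)]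
  note inner = comp_closed[OF pair_closed[OF p1 q1p] e1]
  note outer = pair_closed[OF inner q2p]
  show "h \<in> hom C (Prod C X P) Z" unfolding h_def by (rule comp_closed[OF outer e2])
  assume a: "a \<in> hom C W X" and b: "b \<in> hom C W (IHom C X Y)" and c: "c \<in> hom C W (IHom C Y Z)"
  note bc = pair_closed[OF b c, folded P_def]
  note w = pair_closed[OF a bc]
  show "h \<cdot> pair C a (pair C b c) = Ev C Y Z \<cdot> pair C (Ev C X Y \<cdot> pair C a b) c"
    unfolding h_def comp_assoc[OF w outer e2] pair_comp[OF inner q2p w]
      comp_assoc[OF w pair_closed[OF p1 q1p] e1] pair_comp[OF p1 q1p w]
      comp_assoc[OF w p2 q1] comp_assoc[OF w p2 q2] pr1_pair[OF a bc] pr2_pair[OF a bc]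
      pr1_pair[OF b c] pr2_pair[OF b c] ..
qed

lemma icomp_closed:
  assumes obj: "X \<in> Obj C" "Y \<in> Obj C" "Z \<in> Obj C"
  shows "icomp C X Y Z \<in> hom C (Prod C (IHom C X Y) (IHom C Y Z)) (IHom C X Z)"
  unfolding icomp_def Let_def
  by (rule adj_transpose_closed[OF obj(1) prod_closed icomp_body_closed[OF obj]])
    (simp_all add: obj ihom_closed)

lemma arrow_of_icomp:
  assumes obj: "X \<in> Obj C" "Y \<in> Obj C" "Z \<in> Obj C"
    and p: "p \<in> hom C (One C) (IHom C X Y)" and q: "q \<in> hom C (One C) (IHom C Y Z)"
  shows "arrow_of C X Z (icomp C X Y Z \<cdot> pair C p q) = arrow_of C Y Z q \<cdot> arrow_of C X Y p"
proof -
  note i = id_closed[OF obj(1)]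
  note pt = point_at[OF p obj(1)] and qt = point_at[OF q obj(1)]
  have "arrow_of C X Z (icomp C X Y Z \<cdot> pair C p q) =
      Ev C Y Z \<cdot> pair C (Ev C X Y \<cdot> pair C (Ident C X) (p \<cdot> bang C X)) (q \<cdot> bang C X)"
    unfolding icomp_def Let_def
      arrow_of_adj_transpose[OF icomp_body_closed[OF obj] obj(1) pair_closed[OF p q]]
      pair_comp[OF p q bang_closed[OF obj(1)]]
    by (rule icomp_body_pair[OF obj i pt qt])
  also have "\<dots> = arrow_of C Y Z q \<cdot> arrow_of C X Y p"
    using ev_at_point[OF obj(3) q arrow_of_closed[OF obj(1,2) p]]
    by (simp add: arrow_of_def[of C X Y p])
  finally show ?thesis .
qed

lemma endo_act:
  assumes X: "X \<in> Obj C" and s: "\<sigma> permutes {1..n}"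
  shows endo_act_closed: "endo_act C X n \<sigma> \<in> hom C (IHom C (pow C X n) X) (IHom C (pow C X n) X)"
    and arrow_of_endo_act: "p \<in> hom C (One C) (IHom C (pow C X n) X) \<Longrightarrow>
      arrow_of C (pow C X n) X (endo_act C X n \<sigma> \<cdot> p) =
      arrow_of C (pow C X n) X p \<cdot> permute_coords C X n \<sigma>"
proof -
  let ?N = "pow C X n" and ?H = "IHom C (pow C X n) X"
  note N = pow_closed[OF X, of n]
  note H = ihom_closed[OF N X]
  note s' = permute_coords_closed[OF X s]
  note m = prod_map_closed[OF s' id_closed[OF H]]
  have h: "Ev C ?N X \<cdot> prod_map C (permute_coords C X n \<sigma>) (Ident C ?H) \<in> hom C (Prod C ?N ?H) X"
    by (rule comp_closed[OF m ev_closed[OF N X]])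
  show "endo_act C X n \<sigma> \<in> hom C ?H ?H"
    unfolding endo_act_def Let_def by (rule adj_transpose_closed[OF N H h])
  assume p: "p \<in> hom C (One C) ?H"
  note i = id_closed[OF N] and pt = point_at[OF p N]
  have "arrow_of C ?N X (endo_act C X n \<sigma> \<cdot> p) =
      Ev C ?N X \<cdot> (prod_map C (permute_coords C X n \<sigma>) (Ident C ?H) \<cdot>
        pair C (Ident C ?N) (p \<cdot> bang C ?N))"
    unfolding endo_act_def Let_def arrow_of_adj_transpose[OF h N p]
    by (rule comp_assoc[OF pair_closed[OF i pt] m ev_closed[OF N X]])
  also have "\<dots> = Ev C ?N X \<cdot> pair C (permute_coords C X n \<sigma>) (p \<cdot> bang C ?N)"
    using prod_map_pair[OF s' id_closed[OF H] i pt] comp_id[OF s'] id_comp[OF pt] by simp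
  also have "\<dots> = arrow_of C ?N X p \<cdot> permute_coords C X n \<sigma>"
    by (rule ev_at_point[OF X p s'])
  finally show "arrow_of C ?N X (endo_act C X n \<sigma> \<cdot> p) =
      arrow_of C ?N X p \<cdot> permute_coords C X n \<sigma>" .
qed

text \<open>The arrow \<open>T\<close> is the one of which \<open>insert_op\<close> is the transpose. Evaluated at a family \<open>z\<close> and a
  constant point \<open>q\<close>, it contracts the block by means of the arrow that \<open>q\<close> names.\<close>

lemma insert_op_body:
  fixes X d e i
  defines "N \<equiv> pow C X (d + e - 1)" and "H \<equiv> IHom C (pow C X e) X"
  defines "x \<equiv> \<lambda>k. coord C X (d + e - 1) k \<cdot> Pr1 C N H"
  defines "G \<equiv> \<lambda>c. Ev C (pow C X e) X \<cdot> pair C (tuple C (Prod C N H) c e) (Pr2 C N H)"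
  defines "T \<equiv> tuple C (Prod C N H) (contract_block e i G x) d"
  assumes X: "X \<in> Obj C" and e: "1 \<le> e" and i: "i \<in> {1..d}"
  shows insert_op_body_closed: "T \<in> hom C (Prod C N H) (pow C X d)"
    and insert_op_body_pair: "\<lbrakk>W \<in> Obj C; \<And>k. k \<in> {1..d + e - 1} \<Longrightarrow> z k \<in> hom C W X;
        q \<in> hom C (One C) H\<rbrakk> \<Longrightarrow>
      T \<cdot> pair C (tuple C W z (d + e - 1)) (q \<cdot> bang C W) =
      tuple C W (contract_block e i (\<lambda>c. arrow_of C (pow C X e) X q \<cdot> tuple C W c e) z) d"
proof -
  let ?E = "pow C X e" and ?n = "d + e - 1"
  note E = pow_closed[OF X, of e]
  have N: "N \<in> Obj C" unfolding N_def by (rule pow_closed[OF X])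
  have H: "H \<in> Obj C" unfolding H_def by (rule ihom_closed[OF E X])
  note NH = prod_closed[OF N H] and p1 = pr1_closed[OF N H] and p2 = pr2_closed[OF N H]
  note ev = ev_closed[OF E X, folded H_def]
  have x: "x k \<in> hom C (Prod C N H) X" if "k \<in> {1..?n}" for k
    unfolding x_def by (rule comp_closed[OF p1 coord_closed[OF X that, folded N_def]])
  have block: "i + j - 1 \<in> {1..?n}" if "j \<in> {1..e}" for j using that i by auto
  have xt: "tuple C (Prod C N H) (\<lambda>j. x (i + j - 1)) e \<in> hom C (Prod C N H) ?E"
    by (rule tuple_in_pow[OF NH x[OF block]])
  note xt2 = pair_closed[OF xt p2]
  have G: "G (\<lambda>j. x (i + j - 1)) \<in> hom C (Prod C N H) X"
    unfolding G_def by (rule comp_closed[OF xt2 ev])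
  have T: "contract_block e i G x k \<in> hom C (Prod C N H) X" if "k \<in> {1..d}" for k
    by (rule contract_block_in[where G = G and x = x, OF i e x G that])
  show "T \<in> hom C (Prod C N H) (pow C X d)"
    unfolding T_def by (rule tuple_in_pow[OF NH T])
  assume W: "W \<in> Obj C" and z: "\<And>k. k \<in> {1..?n} \<Longrightarrow> z k \<in> hom C W X"
    and q: "q \<in> hom C (One C) H"
  let ?z = "tuple C W z ?n" and ?q = "q \<cdot> bang C W"
  have zt: "?z \<in> hom C W N" unfolding N_def by (rule tuple_in_pow[OF W z])
  note qt = point_at[OF q W]
  note w = pair_closed[OF zt qt]
  have xz: "x k \<cdot> pair C ?z ?q = z k" if k: "k \<in> {1..?n}" for k
    unfolding x_def N_def coord_pair[OF X zt[unfolded N_def] qt k]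
    by (rule proj_tuple[where Y = "\<lambda>_. X", OF z k])
  let ?b = "\<lambda>j. z (i + j - 1)"
  have bt: "tuple C W ?b e \<in> hom C W ?E" by (rule tuple_in_pow[OF W z[OF block]])
  have "tuple C (Prod C N H) (\<lambda>j. x (i + j - 1)) e \<cdot> pair C ?z ?q =
      tuple C W (\<lambda>j. x (i + j - 1) \<cdot> pair C ?z ?q) e"
    by (rule tuple_comp[where Y = "\<lambda>_. X", OF x[OF block] w])
  also have "\<dots> = tuple C W ?b e" by (rule tuple_cong) (rule xz[OF block])
  finally have Gz: "G (\<lambda>j. x (i + j - 1)) \<cdot> pair C ?z ?q =
      arrow_of C ?E X q \<cdot> tuple C W ?b e"
    unfolding G_def comp_assoc[OF w xt2 ev] pair_comp[OF xt p2 w] pr2_pair[OF zt qt]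
    using ev_at_point[OF X q[unfolded H_def] bt] by simp
  have "T \<cdot> pair C ?z ?q = tuple C W (\<lambda>k. contract_block e i G x k \<cdot> pair C ?z ?q) d"
    unfolding T_def by (rule tuple_comp[where Y = "\<lambda>_. X", OF T w])
  also have "\<dots> = tuple C W
      (contract_block e i (\<lambda>c. arrow_of C ?E X q \<cdot> tuple C W c e) z) d"
  proof (rule tuple_cong)
    fix k assume "k \<in> {1..d}"
    then have "k < i \<Longrightarrow> k \<in> {1..?n}" "\<not> k < i \<Longrightarrow> k \<noteq> i \<Longrightarrow> k + e - 1 \<in> {1..?n}"
      using i e by auto
    then show "contract_block e i G x k \<cdot> pair C ?z ?q =
        contract_block e i (\<lambda>c. arrow_of C ?E X q \<cdot> tuple C W c e) z k"
      using Gz xz[of k] xz[of "k + e - 1"] by (simp add: contract_block_def)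
  qed
  finally show "T \<cdot> pair C ?z ?q =
      tuple C W (contract_block e i (\<lambda>c. arrow_of C ?E X q \<cdot> tuple C W c e) z) d" .
qed

lemma insert_op_eq:
  "insert_op C X d e i =
    (let N = pow C X (d + e - 1); H = IHom C (pow C X e) X in adj_transpose C N H
      (tuple C (Prod C N H) (contract_block e i
        (\<lambda>c. Ev C (pow C X e) X \<cdot> pair C (tuple C (Prod C N H) c e) (Pr2 C N H))
        (\<lambda>k. coord C X (d + e - 1) k \<cdot> Pr1 C N H)) d))"
  unfolding insert_op_def contract_block_def[abs_def] Let_def ..

lemma insert_op_closed:
  assumes "X \<in> Obj C" "1 \<le> e" "i \<in> {1..d}"
  shows "insert_op C X d e i \<in>
    hom C (IHom C (pow C X e) X) (IHom C (pow C X (d + e - 1)) (pow C X d))"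
  unfolding insert_op_eq Let_def
  by (rule adj_transpose_closed[OF _ _ insert_op_body_closed[OF assms]])
    (simp_all add: assms pow_closed ihom_closed)

lemma arrow_of_insert_op_tuple:
  assumes X: "X \<in> Obj C" and e: "1 \<le> e" and i: "i \<in> {1..d}"
    and q: "q \<in> hom C (One C) (IHom C (pow C X e) X)"
    and W: "W \<in> Obj C" and z: "\<And>k. k \<in> {1..d + e - 1} \<Longrightarrow> z k \<in> hom C W X"
  shows "arrow_of C (pow C X (d + e - 1)) (pow C X d) (insert_op C X d e i \<cdot> q) \<cdot>
      tuple C W z (d + e - 1) =
    tuple C W (contract_block e i (\<lambda>c. arrow_of C (pow C X e) X q \<cdot> tuple C W c e) z) d"
proof -
  note op = insert_op_closed[OF X e i]
  note b = bang_closed[OF W]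
  have zt: "tuple C W z (d + e - 1) \<in> hom C W (pow C X (d + e - 1))"
    by (rule tuple_in_pow[OF W z])
  have "arrow_of C (pow C X (d + e - 1)) (pow C X d) (insert_op C X d e i \<cdot> q) \<cdot>
      tuple C W z (d + e - 1) =
      Ev C (pow C X (d + e - 1)) (pow C X d) \<cdot>
        pair C (tuple C W z (d + e - 1)) (insert_op C X d e i \<cdot> (q \<cdot> bang C W))"
    unfolding comp_assoc[OF b q op, symmetric]
    by (rule ev_at_point[OF pow_closed[OF X] comp_closed[OF q op] zt, symmetric])
  also have "\<dots> =
      tuple C W (contract_block e i (\<lambda>c. arrow_of C (pow C X e) X q \<cdot> tuple C W c e) z) d"
    unfolding insert_op_eq Let_def
      ev_adj_transpose[OF insert_op_body_closed[OF X e i] zt point_at[OF q W]]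
    by (rule insert_op_body_pair[OF X e i W z q])
  finally show ?thesis .
qed

lemma endo_comp:
  assumes X: "X \<in> Obj C" and e: "1 \<le> e" and i: "i \<in> {1..d}"
  shows endo_comp_closed: "endo_comp C X d e i \<in> hom C (Prod C (IHom C (pow C X d) X) (IHom C (pow C X e) X))
      (IHom C (pow C X (d + e - 1)) X)"
    and arrow_of_endo_comp: "\<lbrakk>p \<in> hom C (One C) (IHom C (pow C X d) X);
        q \<in> hom C (One C) (IHom C (pow C X e) X)\<rbrakk> \<Longrightarrow>
      arrow_of C (pow C X (d + e - 1)) X (endo_comp C X d e i \<cdot> pair C p q) =
      arrow_of C (pow C X d) X p \<cdot>
        arrow_of C (pow C X (d + e - 1)) (pow C X d) (insert_op C X d e i \<cdot> q)"
proof -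
  let ?D = "pow C X d" and ?E = "pow C X e" and ?N = "pow C X (d + e - 1)"
  let ?H = "IHom C ?D X" and ?K = "IHom C ?E X"
  note D = pow_closed[OF X, of d] and E = pow_closed[OF X, of e]
    and N = pow_closed[OF X, of "d + e - 1"]
  note H = ihom_closed[OF D X] and K = ihom_closed[OF E X]
  note p1 = pr1_closed[OF H K] and p2 = pr2_closed[OF H K]
  note op = insert_op_closed[OF X e i] and ic = icomp_closed[OF N D X]
  note op2 = comp_closed[OF p2 op]
  note swap = pair_closed[OF op2 p1]
  show "endo_comp C X d e i \<in> hom C (Prod C ?H ?K) (IHom C ?N X)"
    unfolding endo_comp_def Let_def by (rule comp_closed[OF swap ic])
  assume p: "p \<in> hom C (One C) ?H" and q: "q \<in> hom C (One C) ?K"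
  note pq = pair_closed[OF p q]
  show "arrow_of C ?N X (endo_comp C X d e i \<cdot> pair C p q) =
      arrow_of C ?D X p \<cdot> arrow_of C ?N ?D (insert_op C X d e i \<cdot> q)"
    unfolding endo_comp_def Let_def comp_assoc[OF pq swap ic] pair_comp[OF op2 p1 pq]
      comp_assoc[OF pq p2 op] pr1_pair[OF p q] pr2_pair[OF p q]
    by (rule arrow_of_icomp[OF N D X comp_closed[OF q op] p])
qed

text \<open>The bridge from the internal composition morphism to partial composition of the arrows named by
  two points.\<close>

lemma latin_hypercube_endo_comp:
  assumes X: "X \<in> Obj C" and d: "1 \<le> d" and e: "1 \<le> e" and i: "i \<in> {1..d}"
    and p: "p \<in> hom C (One C) (IHom C (pow C X d) X)"
    and q: "q \<in> hom C (One C) (IHom C (pow C X e) X)"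
    and f: "latin_hypercube C X d (arrow_of C (pow C X d) X p)"
    and g: "latin_hypercube C X e (arrow_of C (pow C X e) X q)"
  shows "latin_hypercube C X (d + e - 1)
    (arrow_of C (pow C X (d + e - 1)) X (endo_comp C X d e i \<cdot> pair C p q))"
proof (rule latin_hypercube_partial_comp[OF X d e i f g])
  let ?D = "pow C X d" and ?N = "pow C X (d + e - 1)"
  note D = pow_closed[OF X, of d] and N = pow_closed[OF X, of "d + e - 1"]
  have h: "arrow_of C ?N ?D (insert_op C X d e i \<cdot> q) \<in> hom C ?N ?D"
    by (rule arrow_of_closed[OF N D comp_closed[OF q insert_op_closed[OF X e i]]])
  note f' = arrow_of_closed[OF D X p]
  show "arrow_of C ?N X (endo_comp C X d e i \<cdot> pair C p q) \<in> hom C ?N X"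
    unfolding arrow_of_endo_comp[OF X e i p q] by (rule comp_closed[OF h f'])
  fix W z assume W: "W \<in> Obj C" and z: "\<And>k. k \<in> {1..d + e - 1} \<Longrightarrow> z k \<in> hom C W X"
  have zt: "tuple C W z (d + e - 1) \<in> hom C W ?N" by (rule tuple_in_pow[OF W z])
  have op: "arrow_of C ?N ?D (insert_op C X d e i \<cdot> q) \<cdot> tuple C W z (d + e - 1) = tuple C W
      (contract_block e i (\<lambda>b. arrow_of C (pow C X e) X q \<cdot> tuple C W b e) z) d"
    by (rule arrow_of_insert_op_tuple[OF X e i q W z])
  show "arrow_of C ?N X (endo_comp C X d e i \<cdot> pair C p q) \<cdot> tuple C W z (d + e - 1) =
      arrow_of C ?D X p \<cdot> tuple C W
        (contract_block e i (\<lambda>b. arrow_of C (pow C X e) X q \<cdot> tuple C W b e) z) d"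
    unfolding arrow_of_endo_comp[OF X e i p q] comp_assoc[OF zt h f'] op ..
qed

end

section \<open>Monomorphisms and points\<close>

context category
begin

lemma is_pullback_ext:
  assumes P: "is_pullback C f g P p q"
    and u: "u \<in> hom C W P" and v: "v \<in> hom C W P"
    and eq: "p \<cdot> u = p \<cdot> v" "q \<cdot> u = q \<cdot> v"
    and f: "f \<in> hom C A K" and g: "g \<in> hom C B K"
  shows "u = v"
proof -
  note F = dom_cod(1)[OF f] and G = dom_cod(1)[OF g]
  have p: "p \<in> hom C P A" and q: "q \<in> hom C P B" and fg: "f \<cdot> p = g \<cdot> q"
    using P by (auto simp: is_pullback_def F G)
  have "f \<cdot> (p \<cdot> u) = g \<cdot> (q \<cdot> u)"
    using comp_assoc[OF u p f] comp_assoc[OF u q g] fg by simp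
  then have "\<exists>!h. h \<in> hom C W P \<and> p \<cdot> h = p \<cdot> u \<and> q \<cdot> h = q \<cdot> u"
    using P hom_objs[OF u] comp_closed[OF u p] comp_closed[OF u q]
    by (simp add: is_pullback_def F G)
  then show ?thesis using u v eq by metis
qed

lemma monic_cancel:
  assumes "monic C m" "m \<in> hom C A B" "u \<in> hom C W A" "v \<in> hom C W A" "m \<cdot> u = m \<cdot> v"
  shows "u = v"
  using assms hom_objs[OF assms(3)] unfolding monic_def dom_cod(1)[OF assms(2)] by blast

lemma is_pullback_monic:
  assumes P: "is_pullback C f g P p q" and f: "f \<in> hom C A K" and g: "g \<in> hom C B K"
    and m: "monic C g"
  shows "monic C p"
proof -
  note F = dom_cod(1)[OF f] and G = dom_cod(1)[OF g]
  have p: "p \<in> hom C P A" and q: "q \<in> hom C P B" and fg: "f \<cdot> p = g \<cdot> q"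
    using P by (auto simp: is_pullback_def F G)
  have "u = v" if u: "u \<in> hom C W P" and v: "v \<in> hom C W P" and eq: "p \<cdot> u = p \<cdot> v" for W u v
  proof (rule is_pullback_ext[OF P u v eq _ f g])
    have "g \<cdot> (q \<cdot> u) = g \<cdot> (q \<cdot> v)"
      using comp_assoc[OF u p f] comp_assoc[OF u q g] comp_assoc[OF v p f] comp_assoc[OF v q g]
        eq fg by simp
    then show "q \<cdot> u = q \<cdot> v"
      by (rule monic_cancel[OF m g comp_closed[OF u q] comp_closed[OF v q]])
  qed
  then show ?thesis
    unfolding monic_def dom_cod(1)[OF p] using p by (auto simp: hom_def)
qed

end

context cartesian_closed_category
begin

text \<open>Two arrows equalized by \<open>m\<close> agree on points because \<open>m\<close> is injective there, hence are equal by
  faithfulness.\<close>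

lemma monic_if_injective_on_points:
  assumes faithful: "points_faithful C" and m: "m \<in> hom C A B"
    and inj: "\<And>x y. \<lbrakk>x \<in> hom C (One C) A; y \<in> hom C (One C) A; m \<cdot> x = m \<cdot> y\<rbrakk> \<Longrightarrow> x = y"
  shows "monic C m"
proof -
  have "u = v" if u: "u \<in> hom C W A" and v: "v \<in> hom C W A" and eq: "m \<cdot> u = m \<cdot> v" for W u v
  proof -
    have "points_map C u = points_map C v"
      unfolding points_map_def dom_cod(1)[OF u] dom_cod(1)[OF v]
    proof (rule restrict_ext)
      fix w assume w: "w \<in> hom C (One C) W"
      show "u \<cdot> w = v \<cdot> w"
        by (rule inj[OF comp_closed[OF w u] comp_closed[OF w v]])
          (simp add: comp_assoc[OF w u m, symmetric] comp_assoc[OF w v m, symmetric] eq)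
    qed
    moreover have "inj_on (points_map C) (hom C W A)"
      using faithful hom_objs[OF u] by (simp add: points_faithful_def)
    ultimately show ?thesis using u v by (simp add: inj_on_eq_iff)
  qed
  then show ?thesis
    unfolding monic_def dom_cod(1)[OF m] using m by (auto simp: hom_def)
qed

lemma nu:
  assumes Y: "Y \<in> Obj C"
  shows nu_closed: "nu C Y \<in> hom C (Prod C (IHom C Y Y) (IHom C Y Y)) (Prod C (IHom C Y Y) (IHom C Y Y))"
    and nu_pair: "\<lbrakk>p \<in> hom C (One C) (IHom C Y Y); q \<in> hom C (One C) (IHom C Y Y)\<rbrakk> \<Longrightarrow>
      nu C Y \<cdot> pair C p q = pair C (icomp C Y Y Y \<cdot> pair C p q) (icomp C Y Y Y \<cdot> pair C q p)"
proof -
  note H = ihom_closed[OF Y Y] and ic = icomp_closed[OF Y Y Y]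
  note p1 = pr1_closed[OF H H] and p2 = pr2_closed[OF H H]
  note sw = pair_closed[OF p2 p1]
  show "nu C Y \<in> hom C (Prod C (IHom C Y Y) (IHom C Y Y)) (Prod C (IHom C Y Y) (IHom C Y Y))"
    unfolding nu_def Let_def by (rule pair_closed[OF ic comp_closed[OF sw ic]])
  assume p: "p \<in> hom C (One C) (IHom C Y Y)" and q: "q \<in> hom C (One C) (IHom C Y Y)"
  note pq = pair_closed[OF p q]
  show "nu C Y \<cdot> pair C p q = pair C (icomp C Y Y Y \<cdot> pair C p q) (icomp C Y Y Y \<cdot> pair C q p)"
    unfolding nu_def Let_def pair_comp[OF ic comp_closed[OF sw ic] pq] comp_assoc[OF pq sw ic]
      pair_comp[OF p2 p1 pq] pr1_pair[OF p q] pr2_pair[OF p q] ..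
qed

lemma id_point_closed:
  "Y \<in> Obj C \<Longrightarrow> id_point C Y \<in> hom C (One C) (Prod C (IHom C Y Y) (IHom C Y Y))"
  unfolding id_point_def by (intro pair_closed point_of_closed id_closed)

lemma pair_inject:
  assumes "a \<in> hom C W A" "b \<in> hom C W B" "a' \<in> hom C W A" "b' \<in> hom C W B"
    and "pair C a b = pair C a' b'"
  shows "a = a' \<and> b = b'"
  using pr1_pair[OF assms(1,2)] pr1_pair[OF assms(3,4)] pr2_pair[OF assms(1,2)]
    pr2_pair[OF assms(3,4)] assms(5) by simp

lemma pair_eta:
  assumes "u \<in> hom C W (Prod C A B)" "A \<in> Obj C" "B \<in> Obj C"
  shows "u = pair C (Pr1 C A B \<cdot> u) (Pr2 C A B \<cdot> u)"
proof -
  note p = comp_closed[OF assms(1) pr1_closed[OF assms(2,3)]]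
    and q = comp_closed[OF assms(1) pr2_closed[OF assms(2,3)]]
  show ?thesis
    by (rule prod_ext[OF assms(1) pair_closed[OF p q] assms(2,3)])
      (simp_all add: pr1_pair[OF p q] pr2_pair[OF p q])
qed

end

section \<open>Automorphism objects and Latin objects on points\<close>

context cartesian_closed_category_with_pullbacks
begin

lemma pb_closed:
  assumes "f \<in> hom C A K" "g \<in> hom C B K"
  shows "Pb C f g \<in> Obj C" "Pb1 C f g \<in> hom C (Pb C f g) A" "Pb2 C f g \<in> hom C (Pb C f g) B"
    "f \<cdot> Pb1 C f g = g \<cdot> Pb2 C f g"
  using pullbacks[OF assms] by (auto simp: is_pullback_def dom_cod(1)[OF assms(1)] dom_cod(1)[OF assms(2)])

lemma iaut_incl_closed:
  assumes Y: "Y \<in> Obj C"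
  shows "iaut_incl C Y \<in> hom C (iaut C Y) (IHom C Y Y)"
  unfolding iaut_incl_def iaut_def
  by (rule comp_closed[OF pb_closed(2)[OF nu_closed[OF Y] id_point_closed[OF Y]] pr1_closed])
    (rule ihom_closed[OF Y Y])+

text \<open>A point of the pullback is a pair \<open>(p, q)\<close> with \<open>nu(p, q) = (id, id)\<close>, the component in \<open>1\<close> carrying
  no information; translated to arrows, the two equations say that \<open>p\<close> and \<open>q\<close> are mutually inverse.\<close>

lemma iaut_point:
  assumes Y: "Y \<in> Obj C" and x: "x \<in> hom C (One C) (iaut C Y)"
  obtains p q where "p \<in> hom C (One C) (IHom C Y Y)" "q \<in> hom C (One C) (IHom C Y Y)"
    "Pb1 C (nu C Y) (id_point C Y) \<cdot> x = pair C p q" "iaut_incl C Y \<cdot> x = p"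
    "arrow_of C Y Y q \<cdot> arrow_of C Y Y p = Ident C Y"
    "arrow_of C Y Y p \<cdot> arrow_of C Y Y q = Ident C Y"
proof -
  let ?H = "IHom C Y Y" and ?P = "Pb1 C (nu C Y) (id_point C Y)"
    and ?Q = "Pb2 C (nu C Y) (id_point C Y)"
  note H = ihom_closed[OF Y Y] and n = nu_closed[OF Y] and ip = id_point_closed[OF Y]
  note pb = pb_closed[OF n ip, folded iaut_def]
  note px = comp_closed[OF x pb(2)]
  note p1 = pr1_closed[OF H H] and p2 = pr2_closed[OF H H] and ic = icomp_closed[OF Y Y Y]
  define p where "p = Pr1 C ?H ?H \<cdot> (?P \<cdot> x)"
  define q where "q = Pr2 C ?H ?H \<cdot> (?P \<cdot> x)"
  have p: "p \<in> hom C (One C) ?H" unfolding p_def by (rule comp_closed[OF px p1])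
  have q: "q \<in> hom C (One C) ?H" unfolding q_def by (rule comp_closed[OF px p2])
  have pq: "?P \<cdot> x = pair C p q" unfolding p_def q_def by (rule pair_eta[OF px H H])
  have one: "?Q \<cdot> x = Ident C (One C)"
    using bang_unique[OF comp_closed[OF x pb(3)]] bang_unique[OF id_closed[OF one_closed]] by simp
  have "nu C Y \<cdot> pair C p q = id_point C Y"
    using comp_assoc[OF x pb(2) n] comp_assoc[OF x pb(3) ip] pb(4) pq one comp_id[OF ip] by simp
  then have "pair C (icomp C Y Y Y \<cdot> pair C p q) (icomp C Y Y Y \<cdot> pair C q p) =
      pair C (point_of C (Ident C Y)) (point_of C (Ident C Y))"
    unfolding nu_pair[OF Y p q] id_point_def .
  then have "icomp C Y Y Y \<cdot> pair C p q = point_of C (Ident C Y) \<and>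
      icomp C Y Y Y \<cdot> pair C q p = point_of C (Ident C Y)"
    by (rule pair_inject[OF comp_closed[OF pair_closed[OF p q] ic]
      comp_closed[OF pair_closed[OF q p] ic] point_of_closed[OF id_closed[OF Y]]
      point_of_closed[OF id_closed[OF Y]]])
  then have "arrow_of C Y Y q \<cdot> arrow_of C Y Y p = Ident C Y"
      "arrow_of C Y Y p \<cdot> arrow_of C Y Y q = Ident C Y"
    using arrow_of_icomp[OF Y Y Y p q] arrow_of_icomp[OF Y Y Y q p]
      arrow_of_point_of[OF id_closed[OF Y]] by simp_all
  moreover have "iaut_incl C Y \<cdot> x = p"
    unfolding iaut_incl_def p_def by (rule comp_assoc[OF x pb(2) p1])
  ultimately show ?thesis using that[OF p q pq] by blast
qed

lemma iaut_incl_point: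
  assumes Y: "Y \<in> Obj C" and x: "x \<in> hom C (One C) (iaut C Y)"
  shows "arrow_of C Y Y (iaut_incl C Y \<cdot> x) \<in> automorphisms C Y"
proof -
  obtain p q where *: "p \<in> hom C (One C) (IHom C Y Y)" "q \<in> hom C (One C) (IHom C Y Y)"
    "iaut_incl C Y \<cdot> x = p" "arrow_of C Y Y q \<cdot> arrow_of C Y Y p = Ident C Y"
    "arrow_of C Y Y p \<cdot> arrow_of C Y Y q = Ident C Y"
    by (rule iaut_point[OF assms])
  show ?thesis
    unfolding automorphisms_def *(3)
    using arrow_of_closed[OF Y Y *(1)] arrow_of_closed[OF Y Y *(2)] *(4,5) by blast
qed

text \<open>Inverses are unique, so a point of \<open>Aut(Y)\<close> is determined by its first component, and by
  faithfulness injectivity on points is enough.\<close>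

lemma iaut_incl_monic:
  assumes faithful: "points_faithful C" and Y: "Y \<in> Obj C"
  shows "monic C (iaut_incl C Y)"
proof (rule monic_if_injective_on_points[OF faithful iaut_incl_closed[OF Y]])
  fix x x' assume x: "x \<in> hom C (One C) (iaut C Y)" and x': "x' \<in> hom C (One C) (iaut C Y)"
    and eq: "iaut_incl C Y \<cdot> x = iaut_incl C Y \<cdot> x'"
  note n = nu_closed[OF Y] and ip = id_point_closed[OF Y]
  note pb = pb_closed[OF n ip, folded iaut_def]
  obtain p q where *: "p \<in> hom C (One C) (IHom C Y Y)" "q \<in> hom C (One C) (IHom C Y Y)"
    "Pb1 C (nu C Y) (id_point C Y) \<cdot> x = pair C p q" "iaut_incl C Y \<cdot> x = p"
    "arrow_of C Y Y q \<cdot> arrow_of C Y Y p = Ident C Y"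
    by (rule iaut_point[OF Y x])
  obtain p' q' where **: "p' \<in> hom C (One C) (IHom C Y Y)" "q' \<in> hom C (One C) (IHom C Y Y)"
    "Pb1 C (nu C Y) (id_point C Y) \<cdot> x' = pair C p' q'" "iaut_incl C Y \<cdot> x' = p'"
    "arrow_of C Y Y p' \<cdot> arrow_of C Y Y q' = Ident C Y"
    by (rule iaut_point[OF Y x'])
  note a = arrow_of_closed[OF Y Y]
  have p: "p = p'" using eq *(4) **(4) by simp
  have "arrow_of C Y Y q = arrow_of C Y Y q \<cdot> (arrow_of C Y Y p \<cdot> arrow_of C Y Y q')"
    using **(5) comp_id[OF a[OF *(2)]] p by simp
  also have "\<dots> = arrow_of C Y Y q'"
    using comp_assoc[OF a[OF **(2)] a[OF *(1)] a[OF *(2)]] *(5) id_comp[OF a[OF **(2)]] by simp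
  finally have q: "q = q'" by (rule arrow_of_inj[OF Y Y *(2) **(2)])
  show "x = x'"
  proof (rule is_pullback_ext[OF pullbacks[OF n ip, folded iaut_def] x x' _ _ n ip])
    show "Pb1 C (nu C Y) (id_point C Y) \<cdot> x = Pb1 C (nu C Y) (id_point C Y) \<cdot> x'"
      using *(3) **(3) p q by simp
    show "Pb2 C (nu C Y) (id_point C Y) \<cdot> x = Pb2 C (nu C Y) (id_point C Y) \<cdot> x'"
      using bang_unique[OF comp_closed[OF x pb(3)]] bang_unique[OF comp_closed[OF x' pb(3)]]
      by simp
  qed
qed

lemma iaut_closed: "Y \<in> Obj C \<Longrightarrow> iaut C Y \<in> Obj C"
  using hom_objs[OF iaut_incl_closed] by simp

text \<open>On points, \<open>gamma_hat_component\<close> sends \<open>f\<close> to its graph followed by discarding coordinate \<open>i\<close>.\<close>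

lemma gamma_hat_component:
  assumes X: "X \<in> Obj C" and d: "1 \<le> d"
  shows gamma_hat_component_closed: "gamma_hat_component C X d i \<in>
      hom C (IHom C (pow C X d) X) (IHom C (pow C X d) (pow C X d))"
    and arrow_of_gamma_hat_component: "p \<in> hom C (One C) (IHom C (pow C X d) X) \<Longrightarrow>
      arrow_of C (pow C X d) (pow C X d) (gamma_hat_component C X d i \<cdot> p) =
      discard C X d i \<cdot> pair C (Ident C (pow C X d)) (arrow_of C (pow C X d) X p)"
proof -
  let ?D = "pow C X d" and ?H = "IHom C (pow C X d) X"
  note D = pow_closed[OF X, of d]
  note H = ihom_closed[OF D X] and ev = ev_closed[OF D X]
  note p1 = pr1_closed[OF D H] and disc = discard_closed[OF X, of d i]
  note g = graph_closed[OF X d p1 ev]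
  note h = comp_closed[OF g disc]
  show "gamma_hat_component C X d i \<in> hom C ?H (IHom C ?D ?D)"
    unfolding gamma_hat_component_def Let_def by (rule adj_transpose_closed[OF D H h])
  assume p: "p \<in> hom C (One C) ?H"
  note i = id_closed[OF D] and pt = point_at[OF p D]
  note w = pair_closed[OF i pt]
  show "arrow_of C ?D ?D (gamma_hat_component C X d i \<cdot> p) =
      discard C X d i \<cdot> pair C (Ident C ?D) (arrow_of C ?D X p)"
    unfolding gamma_hat_component_def Let_def arrow_of_adj_transpose[OF h D p]
      comp_assoc[OF w g disc] pair_comp[OF p1 ev w] pr1_pair[OF i pt]
    by (simp add: arrow_of_def)
qed

lemma gamma_hat_closed:
  assumes "X \<in> Obj C" "1 \<le> d"
  shows "gamma_hat C X d \<in> hom C (IHom C (pow C X d) X)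
    (fprod C (\<lambda>_. IHom C (pow C X d) (pow C X d)) d)"
  unfolding gamma_hat_def
  by (rule tuple_closed[OF ihom_closed[OF pow_closed[OF assms(1)] assms(1)]
    gamma_hat_component_closed[OF assms]])

lemma iota_hat:
  assumes X: "X \<in> Obj C"
  shows iota_hat_closed: "iota_hat C X d \<in> hom C (fprod C (\<lambda>_. iaut C (pow C X d)) d)
      (fprod C (\<lambda>_. IHom C (pow C X d) (pow C X d)) d)"
    and proj_iota_hat: "\<lbrakk>i \<in> {1..d}; u \<in> hom C W (fprod C (\<lambda>_. iaut C (pow C X d)) d)\<rbrakk> \<Longrightarrow>
      proj C (\<lambda>_. IHom C (pow C X d) (pow C X d)) d i \<cdot> (iota_hat C X d \<cdot> u) =
      iaut_incl C (pow C X d) \<cdot> (proj C (\<lambda>_. iaut C (pow C X d)) d i \<cdot> u)"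
proof -
  let ?A = "\<lambda>_ :: nat. iaut C (pow C X d)" and ?K = "\<lambda>_ :: nat. IHom C (pow C X d) (pow C X d)"
  note D = pow_closed[OF X, of d]
  have A: "\<forall>k \<in> {1..d}. ?A k \<in> Obj C" and K: "\<forall>k \<in> {1..d}. ?K k \<in> Obj C"
    using iaut_closed[OF D] ihom_closed[OF D D] by auto
  note pa = proj_closed[OF A]
  note c = comp_closed[OF pa iaut_incl_closed[OF D]]
  show i: "iota_hat C X d \<in> hom C (fprod C ?A d) (fprod C ?K d)"
    unfolding iota_hat_def Let_def by (rule tuple_closed[OF fprod_closed[OF A] c])
  fix i u
  assume k: "i \<in> {1..d}" and u: "u \<in> hom C W (fprod C ?A d)"
  have "proj C ?K d i \<cdot> iota_hat C X d = iaut_incl C (pow C X d) \<cdot> proj C ?A d i"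
    unfolding iota_hat_def Let_def by (rule proj_tuple[where Y = ?K, OF c k])
  then show "proj C ?K d i \<cdot> (iota_hat C X d \<cdot> u) =
      iaut_incl C (pow C X d) \<cdot> (proj C ?A d i \<cdot> u)"
    using comp_assoc[OF u i proj_closed[OF K k]]
      comp_assoc[OF u pa[OF k] iaut_incl_closed[OF D]] by simp
qed

lemma iota_hat_monic:
  assumes faithful: "points_faithful C" and X: "X \<in> Obj C"
  shows "monic C (iota_hat C X d)"
proof -
  let ?A = "\<lambda>_ :: nat. iaut C (pow C X d)"
  note D = pow_closed[OF X, of d] and i = iota_hat_closed[OF X, of d]
  have A: "\<forall>k \<in> {1..d}. ?A k \<in> Obj C" using iaut_closed[OF D] by simp
  have "u = v" if u: "u \<in> hom C W (fprod C ?A d)" and v: "v \<in> hom C W (fprod C ?A d)"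
      and eq: "iota_hat C X d \<cdot> u = iota_hat C X d \<cdot> v" for W u v
  proof (rule fprod_ext[OF A u v])
    fix k assume k: "k \<in> {1..d}"
    show "proj C ?A d k \<cdot> u = proj C ?A d k \<cdot> v"
      by (rule monic_cancel[OF iaut_incl_monic[OF faithful D] iaut_incl_closed[OF D]
          comp_closed[OF u proj_closed[OF A k]] comp_closed[OF v proj_closed[OF A k]]])
        (simp add: proj_iota_hat[OF X k u, symmetric] proj_iota_hat[OF X k v, symmetric] eq)
  qed
  then show ?thesis
    unfolding monic_def dom_cod(1)[OF i] using i by (auto simp: hom_def)
qed

lemma latin_incl_closed:
  assumes "X \<in> Obj C" "1 \<le> d"
  shows "latin_incl C X d \<in> hom C (latin C X d) (IHom C (pow C X d) X)"
  unfolding latin_incl_def latin_def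
  by (rule pb_closed(2)[OF gamma_hat_closed[OF assms] iota_hat_closed[OF assms(1)]])

lemma latin_incl_monic:
  assumes "points_faithful C" "X \<in> Obj C" "1 \<le> d"
  shows "monic C (latin_incl C X d)"
  unfolding latin_incl_def
  by (rule is_pullback_monic[OF pullbacks[OF gamma_hat_closed[OF assms(2,3)]
    iota_hat_closed[OF assms(2)]] gamma_hat_closed[OF assms(2,3)] iota_hat_closed[OF assms(2)]
    iota_hat_monic[OF assms(1,2)]])

lemma proj_gamma_hat:
  assumes X: "X \<in> Obj C" and d: "1 \<le> d" and i: "i \<in> {1..d}"
    and u: "u \<in> hom C W (IHom C (pow C X d) X)"
  shows "proj C (\<lambda>_. IHom C (pow C X d) (pow C X d)) d i \<cdot> (gamma_hat C X d \<cdot> u) =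
    gamma_hat_component C X d i \<cdot> u"
proof -
  let ?K = "\<lambda>_ :: nat. IHom C (pow C X d) (pow C X d)"
  note D = pow_closed[OF X, of d]
  have K: "\<forall>k \<in> {1..d}. ?K k \<in> Obj C" using ihom_closed[OF D D] by auto
  have "proj C ?K d i \<cdot> gamma_hat C X d = gamma_hat_component C X d i"
    unfolding gamma_hat_def
    by (rule proj_tuple[where Y = ?K, OF gamma_hat_component_closed[OF X d] i])
  then show ?thesis
    using comp_assoc[OF u gamma_hat_closed[OF X d] proj_closed[OF K i]] by simp
qed

text \<open>The pullback equation puts every coordinate of \<open>gamma_hat\<close> at such a point into the image of
  \<open>Aut(X\<^sup>d)\<close>, whose points are automorphisms.\<close>

lemma latin_incl_point:
  assumes X: "X \<in> Obj C" and d: "1 \<le> d" and w: "w \<in> hom C (One C) (latin C X d)"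
  shows "latin_hypercube C X d (arrow_of C (pow C X d) X (latin_incl C X d \<cdot> w))"
proof -
  let ?D = "pow C X d" and ?l = "latin_incl C X d" and ?A = "\<lambda>_ :: nat. iaut C (pow C X d)"
    and ?q = "Pb2 C (gamma_hat C X d) (iota_hat C X d)"
  note D = pow_closed[OF X, of d]
  note g = gamma_hat_closed[OF X d] and io = iota_hat_closed[OF X, of d]
  note pb = pb_closed[OF g io, folded latin_def latin_incl_def]
  have A: "\<forall>k \<in> {1..d}. ?A k \<in> Obj C" using iaut_closed[OF D] by simp
  note lw = comp_closed[OF w pb(2)] and qw = comp_closed[OF w pb(3)]
  have "discard C X d i \<cdot> pair C (Ident C ?D) (arrow_of C ?D X (?l \<cdot> w)) \<in> automorphisms C ?D"
    if i: "i \<in> {1..d}" for i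
  proof -
    have "gamma_hat C X d \<cdot> (?l \<cdot> w) = iota_hat C X d \<cdot> (?q \<cdot> w)"
      using comp_assoc[OF w pb(2) g] comp_assoc[OF w pb(3) io] pb(4) by simp
    then have "gamma_hat_component C X d i \<cdot> (?l \<cdot> w) =
        iaut_incl C ?D \<cdot> (proj C ?A d i \<cdot> (?q \<cdot> w))"
      using proj_gamma_hat[OF X d i lw] proj_iota_hat[OF X i qw] by simp
    then show ?thesis
      using iaut_incl_point[OF D comp_closed[OF qw proj_closed[OF A i]]]
        arrow_of_gamma_hat_component[OF X d lw, of i] by simp
  qed
  then show ?thesis
    unfolding latin_hypercube_iff_automorphisms[OF X d arrow_of_closed[OF D X lw]] by blast
qed

text \<open>The converse direction for families: detection on points lifts each coordinate of
  \<open>gamma_hat \<cdot> \<zeta>\<close> to \<open>Aut(X\<^sup>d)\<close>, and the lifts assemble to an arrow into the pullback.\<close>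

lemma factors_through_latin_inclI:
  assumes detect: "aut_detected_by_points C" and X: "X \<in> Obj C" and d: "1 \<le> d"
    and \<zeta>: "\<zeta> \<in> hom C Z (IHom C (pow C X d) X)"
    and points: "\<And>z. z \<in> hom C (One C) Z \<Longrightarrow>
      latin_hypercube C X d (arrow_of C (pow C X d) X (\<zeta> \<cdot> z))"
  shows "factors_through C \<zeta> (latin_incl C X d)"
proof -
  let ?D = "pow C X d" and ?l = "latin_incl C X d" and ?A = "\<lambda>_ :: nat. iaut C (pow C X d)"
    and ?K = "\<lambda>_ :: nat. IHom C (pow C X d) (pow C X d)"
  note D = pow_closed[OF X, of d]
  note g = gamma_hat_closed[OF X d] and io = iota_hat_closed[OF X, of d]
  note pb = pb_closed[OF g io, folded latin_def latin_incl_def]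
  have Z: "Z \<in> Obj C" using hom_objs[OF \<zeta>] by simp
  have A: "\<forall>k \<in> {1..d}. ?A k \<in> Obj C" using iaut_closed[OF D] by simp
  have K: "\<forall>k \<in> {1..d}. ?K k \<in> Obj C" using ihom_closed[OF D D] by simp
  have "\<exists>u \<in> hom C Z (iaut C ?D). gamma_hat_component C X d i \<cdot> \<zeta> = iaut_incl C ?D \<cdot> u"
    if i: "i \<in> {1..d}" for i
  proof -
    note gc = gamma_hat_component_closed[OF X d, of i]
    note gz = comp_closed[OF \<zeta> gc]
    have "(\<lambda>z. arrow_of C ?D ?D (points_map C (gamma_hat_component C X d i \<cdot> \<zeta>) z))
        \<in> hom C (One C) Z \<rightarrow> automorphisms C ?D"
    proof
      fix z assume z: "z \<in> hom C (One C) Z"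
      note zz = comp_closed[OF z \<zeta>]
      have "discard C X d i \<cdot> pair C (Ident C ?D) (arrow_of C ?D X (\<zeta> \<cdot> z)) \<in> automorphisms C ?D"
        using points[OF z] i
        unfolding latin_hypercube_iff_automorphisms[OF X d arrow_of_closed[OF D X zz]] by blast
      then show "arrow_of C ?D ?D (points_map C (gamma_hat_component C X d i \<cdot> \<zeta>) z)
          \<in> automorphisms C ?D"
        using z arrow_of_gamma_hat_component[OF X d zz, of i] comp_assoc[OF z \<zeta> gc]
        by (simp add: points_map_def dom_cod(1)[OF gz])
    qed
    then have "factors_through C (gamma_hat_component C X d i \<cdot> \<zeta>) (iaut_incl C ?D)"
      using detect D Z gz by (simp add: aut_detected_by_points_def)
    then show ?thesis
      by (simp add: factors_through_def dom_cod(1)[OF gz] dom_cod(1)[OF iaut_incl_closed[OF D]])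
  qed
  then obtain u where u: "\<And>i. i \<in> {1..d} \<Longrightarrow> u i \<in> hom C Z (iaut C ?D)"
      "\<And>i. i \<in> {1..d} \<Longrightarrow> gamma_hat_component C X d i \<cdot> \<zeta> = iaut_incl C ?D \<cdot> u i"
    by metis
  have t: "tuple C Z u d \<in> hom C Z (fprod C ?A d)" by (rule tuple_closed[OF Z u(1)])
  have "gamma_hat C X d \<cdot> \<zeta> = iota_hat C X d \<cdot> tuple C Z u d"
  proof (rule fprod_ext[OF K comp_closed[OF \<zeta> g] comp_closed[OF t io]])
    fix i assume i: "i \<in> {1..d}"
    have "proj C ?A d i \<cdot> tuple C Z u d = u i" by (rule proj_tuple[where Y = ?A, OF u(1) i])
    then show "proj C ?K d i \<cdot> (gamma_hat C X d \<cdot> \<zeta>) =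
        proj C ?K d i \<cdot> (iota_hat C X d \<cdot> tuple C Z u d)"
      unfolding proj_gamma_hat[OF X d i \<zeta>] proj_iota_hat[OF X i t] using u(2)[OF i] by simp
  qed
  then have "\<exists>!h. h \<in> hom C Z (latin C X d) \<and> ?l \<cdot> h = \<zeta> \<and>
      Pb2 C (gamma_hat C X d) (iota_hat C X d) \<cdot> h = tuple C Z u d"
    using pullbacks[OF g io, folded latin_def latin_incl_def] Z \<zeta> t
    by (simp add: is_pullback_def dom_cod(1)[OF g] dom_cod(1)[OF io])
  then show ?thesis
    unfolding factors_through_def dom_cod(1)[OF \<zeta>] dom_cod(1)[OF latin_incl_closed[OF X d]]
    by blast
qed

text \<open>Each condition is a factorization through the Latin object, so by
  \<open>factors_through_latin_inclI\<close> it suffices to check it on points, where it is the corresponding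
  closure property of Latin hypercubes.\<close>

lemma suboperad_latin:
  assumes faithful: "points_faithful C" and detect: "aut_detected_by_points C"
    and X: "X \<in> Obj C"
  shows "suboperad C (endo_operad C X) (latin C X) (latin_incl C X)"
proof -
  let ?l = "latin_incl C X"
  note l = latin_incl_closed[OF X] and fact = factors_through_latin_inclI[OF detect X]
  have obj: "latin C X d \<in> Obj C" if "1 \<le> d" for d using hom_objs[OF l[OF that]] by simp
  have "factors_through C (point_of C (Ident C X)) (?l 1)"
  proof (rule fact)
    note pt = point_of_closed[OF id_closed[OF X]]
    show "point_of C (Ident C X) \<in> hom C (One C) (IHom C (pow C X 1) X)" using pt by simp
    fix z assume "z \<in> hom C (One C) (One C)"
    then have "z = Ident C (One C)" using bang_unique id_closed[OF one_closed] by metis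
    then have "arrow_of C (pow C X 1) X (point_of C (Ident C X) \<cdot> z) = Ident C X"
      using arrow_of_point_of[OF id_closed[OF X]] comp_id[OF pt] by simp
    then show "latin_hypercube C X 1 (arrow_of C (pow C X 1) X (point_of C (Ident C X) \<cdot> z))"
      using latin_hypercube_ident[OF X] by simp
  qed simp
  moreover have "factors_through C (endo_act C X d \<sigma> \<cdot> ?l d) (?l d)"
    if d: "1 \<le> d" and s: "\<sigma> permutes {1..d}" for d \<sigma>
  proof (rule fact[OF d])
    note act = endo_act_closed[OF X s]
    show "endo_act C X d \<sigma> \<cdot> ?l d \<in> hom C (latin C X d) (IHom C (pow C X d) X)"
      by (rule comp_closed[OF l[OF d] act])
    fix z assume z: "z \<in> hom C (One C) (latin C X d)"
    show "latin_hypercube C X d (arrow_of C (pow C X d) X ((endo_act C X d \<sigma> \<cdot> ?l d) \<cdot> z))"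
      unfolding comp_assoc[OF z l[OF d] act] arrow_of_endo_act[OF X s comp_closed[OF z l[OF d]]]
      by (rule latin_hypercube_permute[OF X s latin_incl_point[OF X d z]])
  qed
  moreover have "factors_through C (endo_comp C X d e i \<cdot> prod_map C (?l d) (?l e)) (?l (d + e - 1))"
    if d: "1 \<le> d" and e: "1 \<le> e" and i: "i \<in> {1..d}" for d e i
  proof (rule fact)
    note ec = endo_comp_closed[OF X e i] and pm = prod_map_closed[OF l[OF d] l[OF e]]
    show "endo_comp C X d e i \<cdot> prod_map C (?l d) (?l e) \<in>
        hom C (Prod C (latin C X d) (latin C X e)) (IHom C (pow C X (d + e - 1)) X)"
      by (rule comp_closed[OF pm ec])
    fix z assume z: "z \<in> hom C (One C) (Prod C (latin C X d) (latin C X e))"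
    define a where "a = Pr1 C (latin C X d) (latin C X e) \<cdot> z"
    define b where "b = Pr2 C (latin C X d) (latin C X e) \<cdot> z"
    have a: "a \<in> hom C (One C) (latin C X d)"
      unfolding a_def by (rule comp_closed[OF z pr1_closed[OF obj[OF d] obj[OF e]]])
    have b: "b \<in> hom C (One C) (latin C X e)"
      unfolding b_def by (rule comp_closed[OF z pr2_closed[OF obj[OF d] obj[OF e]]])
    have "z = pair C a b"
      unfolding a_def b_def by (rule pair_eta[OF z obj[OF d] obj[OF e]])
    then have zc: "(endo_comp C X d e i \<cdot> prod_map C (?l d) (?l e)) \<cdot> z =
        endo_comp C X d e i \<cdot> pair C (?l d \<cdot> a) (?l e \<cdot> b)"
      using comp_assoc[OF z pm ec] prod_map_pair[OF l[OF d] l[OF e] a b] by simp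
    show "latin_hypercube C X (d + e - 1) (arrow_of C (pow C X (d + e - 1)) X
        ((endo_comp C X d e i \<cdot> prod_map C (?l d) (?l e)) \<cdot> z))"
      unfolding zc
      by (rule latin_hypercube_endo_comp[OF X d e i comp_closed[OF a l[OF d]]
        comp_closed[OF b l[OF e]] latin_incl_point[OF X d a] latin_incl_point[OF X e b]])
  qed (use d e in simp)
  ultimately show ?thesis
    using obj l latin_incl_monic[OF faithful X]
    unfolding suboperad_def endo_operad_def by simp
qed

end

theorem theorem4p5:
  fixes C :: "('o, 'm) ccc_pb" and X :: 'o
  assumes "cartesian_closed_category_with_pullbacks C"
    and "points_faithful C"
    and "aut_detected_by_points C"
    and "X \<in> Obj C"
  shows "(\<forall>d \<ge> 1. monic C (latin_incl C X d)) \<and>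
    suboperad C (endo_operad C X) (latin C X) (latin_incl C X)"
proof -
  interpret cartesian_closed_category_with_pullbacks C by (rule assms(1))
  show ?thesis
    using latin_incl_monic[OF assms(2,4)] suboperad_latin[OF assms(2-4)] by blast
qed

end
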